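(* Let $J$ be an infinite set, $\varphi\in\mathcal S_{\mathbb P_J}(\mathrm{CAR}(J))$ a symmetric state and $A\in\mathrm{CAR}(J)$. Then, in the weak operator topology, $$\mathrm{w}\text{-}\lim_{I\uparrow J}\frac1{|\mathbb P_I|}\sum_{g\in\mathbb P_I}U_\varphi(g)\pi_\varphi(A)U_\varphi(g)^{-1}=\Phi_\varphi(\pi_\varphi(A)),$$ the limit being along the net of finite subsets $I\subset J$ directed by inclusion.
   Context: $\mathrm{CAR}(J)$ is the unital $C^*$-algebra generated by $\{a_j,a_j^\dagger : j\in J\}$ with $(a_j)^*=a_j^\dagger$, $\{a_j^\dagger,a_k\}=\delta_{jk}1$, $\{a_j,a_k\}=\{a_j^\dagger,a_k^\dagger\}=0$, where $\{a,b\}=ab+ba$. $\mathbb P_J$ is the group of permutations of $J$ moving only finitely many elements, and for $I\subset J$ finite $\mathbb P_I\subset\mathbb P_J$ is the subgroup of permutations of $I$. $\mathbb P_J$ acts on $\mathrm{CAR}(J)$ by the automorphisms $\alpha_g$ with $\alpha_g(a_j)=a_{gj}$; $\mathcal S_{\mathbb P_J}(\mathrm{CAR}(J))$ is the set of states invariant under all $\alpha_g$ (symmetric states). For a symmetric state $\varphi$, $(\pi_\varphi,\mathcal H_\varphi,\Omega_\varphi)$ is its GNS triple and $U_\varphi$ the unitary representation of $\mathbb P_J$ with $\pi_\varphi(\alpha_g(A))=U_\varphi(g)\pi_\varphi(A)U_\varphi(g)^{-1}$, $U_\varphi(g)\Omega_\varphi=\Omega_\varphi$. Let $\mathfrak Z_\varphi=\pi_\varphi(\mathrm{CAR}(J))''\cap\pi_\varphi(\mathrm{CAR}(J))'$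 be the center, and let $\mathfrak B_{\mathbb P_J}(\varphi)=\{Z\in\mathfrak Z_\varphi : U_\varphi(g)ZU_\varphi(g)^{-1}=Z,\ g\in\mathbb P_J\}$. $\Phi_\varphi:\pi_\varphi(\mathrm{CAR}(J))''\to\mathfrak B_{\mathbb P_J}(\varphi)$ is the conditional expectation onto $\mathfrak B_{\mathbb P_J}(\varphi)$ leaving the vector state $\langle\,\cdot\,\Omega_\varphi,\Omega_\varphi\rangle$ invariant (it exists, by a theorem of Størmer, because $\mathbb P_J$ acts as a large group of automorphisms, and is unique since $\Omega_\varphi$ is separating for $\mathfrak B_{\mathbb P_J}(\varphi)$). *)

theory Defs
  imports "HOL-Analysis.Analysis" "HOL-Combinatorics.Permutations"
begin

section \<open>Complex Hilbert spaces and unital C*-algebras\<close>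

class complex_vector = real_vector +
  fixes scaleC :: "complex \<Rightarrow> 'a \<Rightarrow> 'a"  (infixr "*\<^sub>C" 75)
  assumes scaleC_add_right: "c *\<^sub>C (x + y) = c *\<^sub>C x + c *\<^sub>C y"
    and scaleC_add_left: "(c + d) *\<^sub>C x = c *\<^sub>C x + d *\<^sub>C x"
    and scaleC_scaleC: "c *\<^sub>C d *\<^sub>C x = (c * d) *\<^sub>C x"
    and scaleC_of_real: "complex_of_real r *\<^sub>C x = r *\<^sub>R x"

text \<open>The inner product is linear in the first and antilinear in the second argument.
  Positivity and definiteness are part of \<open>cinner_self\<close>.\<close>

class chilbert_space = complex_vector + banach +
  fixes cinner :: "'a \<Rightarrow> 'a \<Rightarrow> complex"
  assumes cinner_add_left: "cinner (x + y) z = cinner x z + cinner y z"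
    and cinner_scaleC_left: "cinner (c *\<^sub>C x) y = c * cinner x y"
    and cinner_commute: "cinner x y = cnj (cinner y x)"
    and cinner_self: "cinner x x = complex_of_real ((norm x)\<^sup>2)"

text \<open>The class \<open>real_normed_algebra_1\<close> includes submultiplicativity of the norm, \<open>0 \<noteq> 1\<close> and
  \<open>norm 1 = 1\<close>.\<close>

class cstar_algebra = complex_vector + real_normed_algebra_1 + banach +
  fixes star :: "'a \<Rightarrow> 'a"
  assumes mult_scaleC_left: "(c *\<^sub>C x) * y = c *\<^sub>C (x * y)"
    and mult_scaleC_right: "x * (c *\<^sub>C y) = c *\<^sub>C (x * y)"
    and norm_scaleC_alg: "norm (c *\<^sub>C x) = cmod c * norm x"
    and star_add: "star (x + y) = star x + star y"
    and star_scaleC: "star (c *\<^sub>C x) = cnj c *\<^sub>C star x"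
    and star_mult: "star (x * y) = star y * star x"
    and star_star: "star (star x) = x"
    and cstar_identity: "norm (star x * x) = (norm x)\<^sup>2"

definition unital_star_subalgebra :: "'a::cstar_algebra set \<Rightarrow> bool" where
  "unital_star_subalgebra B \<longleftrightarrow> 1 \<in> B \<and>
     (\<forall>x\<in>B. \<forall>y\<in>B. x + y \<in> B) \<and> (\<forall>x\<in>B. \<forall>c. c *\<^sub>C x \<in> B) \<and>
     (\<forall>x\<in>B. \<forall>y\<in>B. x * y \<in> B) \<and> (\<forall>x\<in>B. star x \<in> B)"

definition star_automorphism :: "('a::cstar_algebra \<Rightarrow> 'a) \<Rightarrow> bool" where
  "star_automorphism f \<longleftrightarrow> bij f \<and>
     (\<forall>x y. f (x + y) = f x + f y) \<and> (\<forall>c x. f (c *\<^sub>C x) = c *\<^sub>C f x) \<and>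
     (\<forall>x y. f (x * y) = f x * f y) \<and> (\<forall>x. f (star x) = star (f x))"

definition state :: "('a::cstar_algebra \<Rightarrow> complex) \<Rightarrow> bool" where
  "state \<phi> \<longleftrightarrow>
     (\<forall>x y. \<phi> (x + y) = \<phi> x + \<phi> y) \<and> (\<forall>c x. \<phi> (c *\<^sub>C x) = c * \<phi> x) \<and>
     (\<forall>x. \<phi> (star x * x) \<in> \<real>\<^sub>\<ge>\<^sub>0) \<and> \<phi> 1 = 1"


section \<open>The CAR algebra and symmetric states\<close>

text \<open>\<open>car_algebra J a\<close> says that the C*-algebra \<open>'a\<close>, with annihilators \<open>a j\<close> for \<open>j \<in> J\<close> and
  creators \<open>star (a j)\<close>, is \<open>CAR(J)\<close>: a nonzero unital C*-algebra generated by elements satisfying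
  the canonical anticommutation relations, which determine it up to isomorphism. Values of \<open>a\<close>
  outside \<open>J\<close> are irrelevant.\<close>

definition anticommutator :: "'a::ring \<Rightarrow> 'a \<Rightarrow> 'a" where
  "anticommutator x y = x * y + y * x"

definition car_algebra :: "'j set \<Rightarrow> ('j \<Rightarrow> 'a::cstar_algebra) \<Rightarrow> bool" where
  "car_algebra J a \<longleftrightarrow>
     (\<forall>j\<in>J. \<forall>k\<in>J. anticommutator (star (a j)) (a k) = (if j = k then 1 else 0)) \<and>
     (\<forall>j\<in>J. \<forall>k\<in>J. anticommutator (a j) (a k) = 0) \<and>
     (\<forall>j\<in>J. \<forall>k\<in>J. anticommutator (star (a j)) (star (a k)) = 0) \<and>
     (\<lambda>B. unital_star_subalgebra B \<and> closed B) hull (a ` J \<union> (star \<circ> a) ` J) = UNIV"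

definition finitary_permutations :: "'j set \<Rightarrow> ('j \<Rightarrow> 'j) set" where
  "finitary_permutations J = {g. g permutes J \<and> finite {j. g j \<noteq> j}}"

definition car_permutation_action ::
    "'j set \<Rightarrow> ('j \<Rightarrow> 'a::cstar_algebra) \<Rightarrow> (('j \<Rightarrow> 'j) \<Rightarrow> 'a \<Rightarrow> 'a) \<Rightarrow> bool" where
  "car_permutation_action J a \<alpha> \<longleftrightarrow>
     (\<forall>g\<in>finitary_permutations J. star_automorphism (\<alpha> g) \<and> (\<forall>j\<in>J. \<alpha> g (a j) = a (g j))) \<and>
     (\<forall>g\<in>finitary_permutations J. \<forall>h\<in>finitary_permutations J. \<alpha> (g \<circ> h) = \<alpha> g \<circ> \<alpha> h)"

definition symmetric_states ::
    "'j set \<Rightarrow> (('j \<Rightarrow> 'j) \<Rightarrow> 'a \<Rightarrow> 'a) \<Rightarrow> ('a::cstar_algebra \<Rightarrow> complex) set" where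
  "symmetric_states J \<alpha> =
     {\<phi>. state \<phi> \<and> (\<forall>g\<in>finitary_permutations J. \<forall>x. \<phi> (\<alpha> g x) = \<phi> x)}"


section \<open>Operators on a Hilbert space\<close>

definition bounded_clinear :: "('h::chilbert_space \<Rightarrow> 'h) \<Rightarrow> bool" where
  "bounded_clinear T \<longleftrightarrow> bounded_linear T \<and> (\<forall>c x. T (c *\<^sub>C x) = c *\<^sub>C T x)"

definition unitary :: "('h::chilbert_space \<Rightarrow> 'h) \<Rightarrow> bool" where
  "unitary T \<longleftrightarrow> bounded_clinear T \<and> surj T \<and> (\<forall>x y. cinner (T x) (T y) = cinner x y)"

definition positive_op :: "('h::chilbert_space \<Rightarrow> 'h) \<Rightarrow> bool" where
  "positive_op T \<longleftrightarrow> bounded_clinear T \<and> (\<forall>x. cinner (T x) x \<in> \<real>\<^sub>\<ge>\<^sub>0)"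

definition commutant :: "('h::chilbert_space \<Rightarrow> 'h) set \<Rightarrow> ('h \<Rightarrow> 'h) set" where
  "commutant S = {T. bounded_clinear T \<and> (\<forall>X\<in>S. T \<circ> X = X \<circ> T)}"

definition wot_tendsto ::
    "('i \<Rightarrow> 'h \<Rightarrow> 'h::chilbert_space) \<Rightarrow> ('h \<Rightarrow> 'h) \<Rightarrow> 'i filter \<Rightarrow> bool" where
  "wot_tendsto T S F \<longleftrightarrow> (\<forall>x y. ((\<lambda>i. cinner (T i x) y) \<longlongrightarrow> cinner (S x) y) F)"

text \<open>Conditional expectation of the operator algebra \<open>M\<close> onto its subalgebra \<open>N\<close>: a positive
  linear \<open>N\<close>-bimodule map from \<open>M\<close> to \<open>N\<close> that fixes \<open>N\<close> pointwise. Values of \<open>\<Phi>\<close> outside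
  \<open>M\<close> are irrelevant.\<close>

definition conditional_expectation ::
    "('h::chilbert_space \<Rightarrow> 'h) set \<Rightarrow> ('h \<Rightarrow> 'h) set \<Rightarrow> (('h \<Rightarrow> 'h) \<Rightarrow> 'h \<Rightarrow> 'h) \<Rightarrow> bool" where
  "conditional_expectation M N \<Phi> \<longleftrightarrow>
     (\<forall>X\<in>M. \<Phi> X \<in> N) \<and> (\<forall>Z\<in>N. \<Phi> Z = Z) \<and>
     (\<forall>X\<in>M. \<forall>Y\<in>M. \<Phi> (\<lambda>x. X x + Y x) = (\<lambda>x. \<Phi> X x + \<Phi> Y x)) \<and>
     (\<forall>X\<in>M. \<forall>c. \<Phi> (\<lambda>x. c *\<^sub>C X x) = (\<lambda>x. c *\<^sub>C \<Phi> X x)) \<and>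
     (\<forall>X\<in>M. positive_op X \<longrightarrow> positive_op (\<Phi> X)) \<and>
     (\<forall>X\<in>M. \<forall>Z\<in>N. \<forall>W\<in>N. \<Phi> (Z \<circ> X \<circ> W) = Z \<circ> \<Phi> X \<circ> W)"


section \<open>The GNS representation of a symmetric state\<close>

definition star_representation :: "('a::cstar_algebra \<Rightarrow> 'h::chilbert_space \<Rightarrow> 'h) \<Rightarrow> bool" where
  "star_representation \<pi> \<longleftrightarrow>
     (\<forall>A. bounded_clinear (\<pi> A)) \<and> \<pi> 1 = id \<and>
     (\<forall>A B x. \<pi> (A + B) x = \<pi> A x + \<pi> B x) \<and> (\<forall>c A x. \<pi> (c *\<^sub>C A) x = c *\<^sub>C \<pi> A x) \<and>
     (\<forall>A B. \<pi> (A * B) = \<pi> A \<circ> \<pi> B) \<and>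
     (\<forall>A x y. cinner (\<pi> (star A) x) y = cinner x (\<pi> A y))"

definition gns_triple ::
    "('a::cstar_algebra \<Rightarrow> complex) \<Rightarrow> ('a \<Rightarrow> 'h::chilbert_space \<Rightarrow> 'h) \<Rightarrow> 'h \<Rightarrow> bool" where
  "gns_triple \<phi> \<pi> \<Omega> \<longleftrightarrow> star_representation \<pi> \<and>
     closure (range (\<lambda>A. \<pi> A \<Omega>)) = UNIV \<and> (\<forall>A. cinner (\<pi> A \<Omega>) \<Omega> = \<phi> A)"

definition gns_permutation_rep ::
    "'j set \<Rightarrow> (('j \<Rightarrow> 'j) \<Rightarrow> 'a \<Rightarrow> 'a) \<Rightarrow> ('a::cstar_algebra \<Rightarrow> 'h::chilbert_space \<Rightarrow> 'h) \<Rightarrow> 'h \<Rightarrow>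
     (('j \<Rightarrow> 'j) \<Rightarrow> 'h \<Rightarrow> 'h) \<Rightarrow> bool" where
  "gns_permutation_rep J \<alpha> \<pi> \<Omega> U \<longleftrightarrow>
     (\<forall>g\<in>finitary_permutations J. unitary (U g) \<and> U g \<Omega> = \<Omega> \<and>
        (\<forall>A. \<pi> (\<alpha> g A) = U g \<circ> \<pi> A \<circ> inv (U g))) \<and>
     (\<forall>g\<in>finitary_permutations J. \<forall>h\<in>finitary_permutations J. U (g \<circ> h) = U g \<circ> U h)"

definition generated_vN_algebra ::
    "('a::cstar_algebra \<Rightarrow> 'h::chilbert_space \<Rightarrow> 'h) \<Rightarrow> ('h \<Rightarrow> 'h) set" where
  "generated_vN_algebra \<pi> = commutant (commutant (range \<pi>))"

definition rep_center ::
    "('a::cstar_algebra \<Rightarrow> 'h::chilbert_space \<Rightarrow> 'h) \<Rightarrow> ('h \<Rightarrow> 'h) set" where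
  "rep_center \<pi> = generated_vN_algebra \<pi> \<inter> commutant (range \<pi>)"

definition invariant_center ::
    "'j set \<Rightarrow> ('a::cstar_algebra \<Rightarrow> 'h::chilbert_space \<Rightarrow> 'h) \<Rightarrow> (('j \<Rightarrow> 'j) \<Rightarrow> 'h \<Rightarrow> 'h) \<Rightarrow>
     ('h \<Rightarrow> 'h) set" where
  "invariant_center J \<pi> U =
     {Z \<in> rep_center \<pi>. \<forall>g\<in>finitary_permutations J. U g \<circ> Z \<circ> inv (U g) = Z}"

definition invariant_expectation ::
    "'j set \<Rightarrow> ('a::cstar_algebra \<Rightarrow> 'h::chilbert_space \<Rightarrow> 'h) \<Rightarrow> 'h \<Rightarrow> (('j \<Rightarrow> 'j) \<Rightarrow> 'h \<Rightarrow> 'h) \<Rightarrow>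
     (('h \<Rightarrow> 'h) \<Rightarrow> 'h \<Rightarrow> 'h) \<Rightarrow> bool" where
  "invariant_expectation J \<pi> \<Omega> U \<Phi> \<longleftrightarrow>
     conditional_expectation (generated_vN_algebra \<pi>) (invariant_center J \<pi> U) \<Phi> \<and>
     (\<forall>X\<in>generated_vN_algebra \<pi>. cinner (\<Phi> X \<Omega>) \<Omega> = cinner (X \<Omega>) \<Omega>)"

end

theory Submission imports Defs begin

text \<open>Let \<open>M\<^sub>I A\<close> be the average of \<open>\<alpha>\<^sub>g A\<close> over the permutations \<open>g\<close> of \<open>I\<close>. For words \<open>A\<close> and
  \<open>B\<close> in the generators, most permutations of a large \<open>I\<close> move the support of \<open>A\<close> away from that of
  \<open>B\<close>. Hence \<open>[M\<^sub>I A, B]\<close> tends to \<open>0\<close> in norm if \<open>A\<close> is even, and if \<open>A\<close> is odd then \<open>M\<^sub>I A\<close>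
  itself tends to \<open>0\<close>, because its anticommutator with its adjoint does. By density the averages
  are asymptotically central. By the mean ergodic theorem \<open>\<pi> (M\<^sub>I A) \<Omega>\<close> converges, hence so does
  \<open>\<pi> (M\<^sub>I A) (\<pi> B \<Omega>)\<close>, and as \<open>\<Omega>\<close> is cyclic the \<open>\<pi> (M\<^sub>I A)\<close> converge strongly to an element of
  the invariant center. This limit and \<open>\<Phi> (\<pi> A)\<close> agree when tested on the invariant center in the
  vector state of \<open>\<Omega>\<close>, which is faithful there.\<close>

section \<open>Complex Hilbert spaces\<close>

text \<open>The class axioms tie the norm to real scalars only; complex homogeneity comes from
  sesquilinearity through \<open>cinner_self\<close>.\<close>

lemma norm_scaleC: "norm (c *\<^sub>C x) = cmod c * norm x" for x :: "'h::chilbert_space"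
proof -
  have "complex_of_real ((norm (c *\<^sub>C x))\<^sup>2) = cinner (c *\<^sub>C x) (c *\<^sub>C x)"
    by (rule cinner_self[symmetric])
  also have "\<dots> = c * cnj (c * cinner x x)"
    by (metis cinner_scaleC_left cinner_commute)
  also have "\<dots> = complex_of_real ((cmod c * norm x)\<^sup>2)"
    using complex_norm_square[of c] by (simp add: cinner_self power_mult_distrib mult_ac)
  finally show ?thesis
    by (simp add: of_real_eq_iff[symmetric] del: of_real_power)
qed

lemma cinner_add_right: "cinner x (y + z) = cinner x y + cinner x z"
  for x y z :: "'h::chilbert_space"
  by (metis cinner_add_left cinner_commute complex_cnj_add)

lemma cinner_scaleC_right: "cinner x (c *\<^sub>C y) = cnj c * cinner x y"
  for x y :: "'h::chilbert_space"
  by (metis cinner_commute cinner_scaleC_left complex_cnj_mult)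

lemma cinner_scaleR_left: "cinner (r *\<^sub>R x) y = r *\<^sub>R cinner x y"
  and cinner_scaleR_right: "cinner x (r *\<^sub>R y) = r *\<^sub>R cinner x y"
  for x y :: "'h::chilbert_space"
  by (simp_all flip: scaleC_of_real
      add: cinner_scaleC_left cinner_scaleC_right scaleR_conv_of_real)

text \<open>Cauchy-Schwarz: the squared norm of \<langle>y,y\<rangle> x - \<langle>x,y\<rangle> y is
  nonnegative and factors through the difference of the two sides.\<close>

lemma norm_cinner_le: "cmod (cinner x y) \<le> norm x * norm y" for x y :: "'h::chilbert_space"
proof (cases "y = 0")
  case True
  then show ?thesis
    using cinner_scaleR_right[of x 0 y] by simp
next
  case False
  define n p where "n = complex_of_real ((norm y)\<^sup>2)" and "p = cinner x y"
  have p: "cinner y x = cnj p" "p * cnj p = complex_of_real ((cmod p)\<^sup>2)" "cnj n = n"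
    by (simp_all only: p_def n_def cinner_commute[of y x] complex_norm_square complex_cnj_complex_of_real)
  have "complex_of_real ((norm (n *\<^sub>C x + (- p) *\<^sub>C y))\<^sup>2)
      = n * n * cinner x x - n * (p * cnj p) - n * (p * cnj p) + p * cnj p * cinner y y"
    by (simp only: cinner_self[symmetric] cinner_add_left cinner_add_right cinner_scaleC_left
        cinner_scaleC_right) (simp add: p p_def[symmetric] algebra_simps del: of_real_power)
  also have "\<dots> = n * (n * complex_of_real ((norm x)\<^sup>2) - complex_of_real ((cmod p)\<^sup>2))"
    unfolding p cinner_self n_def[symmetric] by (simp only: algebra_simps)
  finally have "(norm (n *\<^sub>C x + (- p) *\<^sub>C y))\<^sup>2
      = (norm y)\<^sup>2 * ((norm y * norm x)\<^sup>2 - (cmod (cinner x y))\<^sup>2)"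
    unfolding n_def of_real_mult[symmetric] of_real_diff[symmetric] of_real_eq_iff
    by (simp add: p_def power_mult_distrib)
  then have "0 \<le> (norm y)\<^sup>2 * ((norm y * norm x)\<^sup>2 - (cmod (cinner x y))\<^sup>2)"
    by (metis zero_le_power2)
  then have "(cmod (cinner x y))\<^sup>2 \<le> (norm y * norm x)\<^sup>2"
    using False by (simp add: zero_le_mult_iff)
  then show ?thesis
    by (metis mult.commute norm_ge_zero mult_nonneg_nonneg power2_le_imp_le)
qed

lemma bounded_bilinear_cinner: "bounded_bilinear (cinner :: 'h::chilbert_space \<Rightarrow> 'h \<Rightarrow> complex)"
  by unfold_locales (auto simp: cinner_add_left cinner_add_right cinner_scaleR_left
      cinner_scaleR_right intro!: exI[of _ 1] norm_cinner_le)

lemmas tendsto_cinner = bounded_bilinear.tendsto[OF bounded_bilinear_cinner]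
lemmas cinner_diff_left = bounded_bilinear.diff_left[OF bounded_bilinear_cinner]
lemmas cinner_diff_right = bounded_bilinear.diff_right[OF bounded_bilinear_cinner]
lemmas bounded_linear_cinner_left = bounded_bilinear.bounded_linear_left[OF bounded_bilinear_cinner]

lemma norm_sq_diff:
  "(norm (x - y))\<^sup>2 = (norm x)\<^sup>2 - 2 * Re (cinner x y) + (norm y)\<^sup>2" for x y :: "'h::chilbert_space"
proof -
  have "complex_of_real ((norm (x - y))\<^sup>2)
      = cinner x x - cinner x y - cnj (cinner x y) + cinner y y"
    unfolding cinner_self[symmetric]
    by (simp add: cinner_diff_left cinner_diff_right cinner_commute[of y x])
  then have "Re (complex_of_real ((norm (x - y))\<^sup>2))
      = Re (cinner x x - cinner x y - cnj (cinner x y) + cinner y y)"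
    by simp
  then show ?thesis
    by (simp add: cinner_self del: of_real_power)
qed

lemma bounded_clinearD:
  assumes "bounded_clinear T"
  shows "bounded_linear T" "linear T" "T (x + y) = T x + T y" "T (x - y) = T x - T y"
    "T (c *\<^sub>C x) = c *\<^sub>C T x" "T (r *\<^sub>R x) = r *\<^sub>R T x" "T (sum f S) = (\<Sum>i\<in>S. T (f i))"
  using assms by (auto simp: bounded_clinear_def bounded_linear.linear linear_add linear_diff
      linear_scale linear_sum)

lemma bounded_linear_scaleC: "bounded_linear (\<lambda>x::'h::chilbert_space. c *\<^sub>C x)"
proof (rule bounded_linear_intro[where K = "cmod c"])
  show "c *\<^sub>C (r *\<^sub>R x) = r *\<^sub>R (c *\<^sub>C x)" for r and x :: 'h
    by (metis scaleC_of_real scaleC_scaleC mult.commute)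
qed (simp_all add: scaleC_add_right norm_scaleC)

lemma bounded_clinear_id: "bounded_clinear id"
  by (simp add: bounded_clinear_def bounded_linear_ident id_def)

lemma bounded_clinear_diff:
  assumes "bounded_clinear S" "bounded_clinear T"
  shows "bounded_clinear (\<lambda>x. S x - T x)"
  using assms
  by (simp add: bounded_clinear_def bounded_linear_sub linear_diff
      bounded_linear.linear[OF bounded_linear_scaleC])

lemma unitaryD:
  assumes "unitary T"
  shows "bounded_clinear T" "bij T" "cinner (T x) (T y) = cinner x y" "norm (T x) = norm x"
    "T (inv T x) = x" "inv T (T x) = x"
proof -
  show T: "bounded_clinear T" and c: "cinner (T x) (T y) = cinner x y" for x y
    using assms by (auto simp: unitary_def)
  have n: "norm (T x) = norm x" for x
  proof -
    have "complex_of_real ((norm (T x))\<^sup>2) = complex_of_real ((norm x)\<^sup>2)"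
      by (simp only: cinner_self[symmetric] c)
    then show ?thesis
      by (simp add: of_real_eq_iff del: of_real_power)
  qed
  then show "norm (T x) = norm x" .
  have "inj T"
    by (rule injI) (metis T bounded_clinearD(4) n norm_eq_zero eq_iff_diff_eq_0)
  moreover have "surj T"
    using assms by (simp add: unitary_def)
  ultimately show "bij T" "T (inv T x) = x" "inv T (T x) = x"
    by (auto simp: bij_def surj_f_inv_f)
qed

section \<open>Polarization and real quadratic forms\<close>

lemma cinner_polarization:
  "4 * cinner (T x) y = cinner (T (x + y)) (x + y) - cinner (T (x - y)) (x - y)
     + \<i> * cinner (T (x + \<i> *\<^sub>C y)) (x + \<i> *\<^sub>C y) - \<i> * cinner (T (x - \<i> *\<^sub>C y)) (x - \<i> *\<^sub>C y)"
  if "bounded_clinear T"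
  by (simp add: bounded_clinearD[OF that] cinner_add_left cinner_add_right cinner_diff_left
      cinner_diff_right cinner_scaleC_left cinner_scaleC_right algebra_simps)

text \<open>The forms \<open>cinner (T x) y\<close> and \<open>cinner x (T y)\<close> have the same
  quadratic form when it is real, so polarization makes them equal. This turns positivity of an
  expectation into symmetry.\<close>

lemma symmetric_if_real_form:
  assumes T: "bounded_clinear T" and r: "\<And>x. cinner (T x) x \<in> \<real>"
  shows "cinner (T x) y = cinner x (T y)"
proof -
  have c: "cinner z (T z) = cinner (T z) z" for z
    using r[of z] by (metis Reals_cnj_iff cinner_commute)
  have "4 * cinner x (T y) = cinner (x + y) (T (x + y)) - cinner (x - y) (T (x - y))
     + \<i> * cinner (x + \<i> *\<^sub>C y) (T (x + \<i> *\<^sub>C y)) - \<i> * cinner (x - \<i> *\<^sub>C y) (T (x - \<i> *\<^sub>C y))"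
    by (simp add: bounded_clinearD[OF T] cinner_add_left cinner_add_right cinner_diff_left
      cinner_diff_right cinner_scaleC_left cinner_scaleC_right algebra_simps)
  then have "4 * cinner (T x) y = 4 * cinner x (T y)"
    unfolding c cinner_polarization[OF T] by simp
  then show ?thesis
    by simp
qed

lemma real_form_if_symmetric:
  assumes "\<And>x y. cinner (T x) y = cinner x (T y)"
  shows "cinner (T x) x \<in> \<real>"
  by (metis assms Reals_cnj_iff cinner_commute)

section \<open>Convergence of nets\<close>

text \<open>Completeness in filter form, since the limits here run along finite subsets of
  \<open>J\<close> rather than along a sequence.\<close>

lemma cauchy_net_converges:
  fixes f :: "'i \<Rightarrow> 'h::banach"
  assumes "F \<noteq> bot"
    and "\<And>e. e > 0 \<Longrightarrow> \<exists>P. eventually P F \<and> (\<forall>i j. P i \<and> P j \<longrightarrow> dist (f i) (f j) < e)"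
  shows "\<exists>l. (f \<longlongrightarrow> l) F"
proof -
  have "cauchy_filter (filtermap f F)"
    unfolding cauchy_filter_metric_filtermap using assms(2) by blast
  moreover have "filtermap f F \<noteq> bot"
    using assms(1) by (simp add: filtermap_bot_iff)
  ultimately obtain l where "filtermap f F \<le> nhds l"
    using cauchy_filter_complete_converges[of "filtermap f F" UNIV] complete_UNIV by auto
  then show ?thesis
    by (auto simp: filterlim_def)
qed

text \<open>The hypothesis is Pythagoras for projections onto decreasing subspaces. Squared norms
  then decrease along inclusion, and their convergence to the infimum makes the net Cauchy.\<close>

lemma nested_projection_net_converges:
  fixes v :: "'i set \<Rightarrow> 'h::banach"
  assumes v: "\<And>I I'. finite I' \<Longrightarrow> I' \<subseteq> J \<Longrightarrow> I \<subseteq> I' \<Longrightarrow>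
      (norm (v I - v I'))\<^sup>2 = (norm (v I))\<^sup>2 - (norm (v I'))\<^sup>2"
  shows "\<exists>l. (v \<longlongrightarrow> l) (finite_subsets_at_top J)"
proof (rule cauchy_net_converges)
  fix e :: real
  assume e: "e > 0"
  define N where "N = (\<lambda>I. (norm (v I))\<^sup>2) ` {I. finite I \<and> I \<subseteq> J}"
  have N: "N \<noteq> {}" "bdd_below N"
    by (auto simp: N_def intro!: bdd_belowI[of _ 0])
  \<comment> \<open>The index \<open>I0\<close> nearly attains the infimum; by Pythagoras every
    later vector lies within \<open>e / 2\<close> of \<open>v I0\<close>.\<close>
  then have "\<exists>n\<in>N. n < Inf N + (e / 2)\<^sup>2"
    using e by (simp flip: cInf_less_iff)
  then obtain I0 where I0: "finite I0" "I0 \<subseteq> J" "(norm (v I0))\<^sup>2 < Inf N + (e / 2)\<^sup>2"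
    by (auto simp: N_def)
  define P where "P I \<longleftrightarrow> finite I \<and> I0 \<subseteq> I \<and> I \<subseteq> J" for I
  have near: "dist (v I0) (v I) < e / 2" if "P I" for I
  proof -
    have "(norm (v I))\<^sup>2 \<in> N"
      using that by (auto simp: P_def N_def)
    then have "Inf N \<le> (norm (v I))\<^sup>2"
      using N by (simp add: cInf_lower)
    then have "(norm (v I0 - v I))\<^sup>2 < (e / 2)\<^sup>2"
      using v[of I I0] that I0 by (simp add: P_def)
    then show ?thesis
      using e unfolding dist_norm by (intro power2_less_imp_less[of _ "e / 2"]) auto
  qed
  have "dist (v I) (v I') < e" if "P I" "P I'" for I I'
    using near[OF that(1)] near[OF that(2)] dist_triangle3[of "v I" "v I'" "v I0"] by simp
  moreover have "eventually P (finite_subsets_at_top J)"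
    unfolding P_def eventually_finite_subsets_at_top using I0 by blast
  ultimately show "\<exists>P. eventually P (finite_subsets_at_top J) \<and>
      (\<forall>i j. P i \<and> P j \<longrightarrow> dist (v i) (v j) < e)"
    by blast
qed simp

text \<open>At an arbitrary point the net is Cauchy: replace the point by a nearby one in
  \<open>D\<close>, at a cost that the common bound keeps uniform in the index.\<close>

lemma equibounded_net_converges:
  fixes T :: "'i \<Rightarrow> 'h::banach \<Rightarrow> 'h"
  assumes F: "F \<noteq> bot"
    and lin: "\<And>i. linear (T i)"
    and bound: "\<forall>\<^sub>F i in F. \<forall>x. norm (T i x) \<le> K * norm x"
    and conv: "\<And>d. d \<in> D \<Longrightarrow> \<exists>l. ((\<lambda>i. T i d) \<longlongrightarrow> l) F"
    and dense: "closure D = UNIV"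
  shows "\<exists>l. ((\<lambda>i. T i x) \<longlongrightarrow> l) F"
proof (rule cauchy_net_converges[OF F])
  fix e :: real
  assume e: "e > 0"
  \<comment> \<open>\<open>K\<close> may be zero or negative, whereas \<open>k\<close> dominates it
    and can be divided by.\<close>
  define k where "k = \<bar>K\<bar> + 1"
  have k: "k > 0"
    by (simp add: k_def)
  have "x \<in> closure D"
    by (simp add: dense)
  then obtain d where d: "d \<in> D" "dist d x < e / (4 * k)"
    using e k unfolding closure_approachable
    by (meson divide_pos_pos mult_pos_pos zero_less_numeral)
  obtain l where l: "((\<lambda>i. T i d) \<longlongrightarrow> l) F"
    using conv d(1) by blast
  define P where "P i \<longleftrightarrow> (\<forall>x. norm (T i x) \<le> K * norm x) \<and> dist (T i d) l < e / 4" for i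
  have near: "dist (T i x) l < e / 2" if "P i" for i
  proof -
    have "dist (T i x) (T i d) = norm (T i (x - d))"
      by (simp add: dist_norm linear_diff[OF lin])
    also have "\<dots> \<le> k * norm (x - d)"
    proof -
      have "norm (T i (x - d)) \<le> K * norm (x - d)"
        using that by (simp add: P_def)
      also have "\<dots> \<le> k * norm (x - d)"
        by (rule mult_right_mono) (auto simp: k_def)
      finally show ?thesis .
    qed
    also have "\<dots> < k * (e / (4 * k))"
      using d(2) k by (intro mult_strict_left_mono) (auto simp: dist_norm norm_minus_commute)
    also have "\<dots> = e / 4"
      using k by simp
    finally show ?thesis
      using that dist_triangle[of "T i x" l "T i d"] by (simp add: P_def)
  qed
  have "dist (T i x) (T j x) < e" if "P i" "P j" for i j
    using near[OF that(1)] near[OF that(2)] dist_triangle2[of "T i x" "T j x" l] by simp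
  moreover have "eventually P F"
    unfolding P_def using bound tendstoD[OF l, of "e / 4"] e by (simp add: eventually_conj)
  ultimately show "\<exists>P. eventually P F \<and> (\<forall>i j. P i \<and> P j \<longrightarrow> dist (T i x) (T j x) < e)"
    by blast
qed

section \<open>Averages over finite permutation groups\<close>

text \<open>Values lie in any real vector space, so that one notion serves algebra elements, vectors
  and complex numbers, and linear maps pass from one to another.\<close>

definition perm_avg :: "'j set \<Rightarrow> (('j \<Rightarrow> 'j) \<Rightarrow> 'v::real_vector) \<Rightarrow> 'v" where
  "perm_avg I f = (1 / real (card {g. g permutes I})) *\<^sub>R (\<Sum>g | g permutes I. f g)"

lemma perm_avg_cong: "(\<And>g. g permutes I \<Longrightarrow> f g = h g) \<Longrightarrow> perm_avg I f = perm_avg I h"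
  by (simp add: perm_avg_def)

lemma perm_avg_const:
  assumes "finite I"
  shows "perm_avg I (\<lambda>_. x) = x"
  using card_permutations[OF refl assms] by (simp add: perm_avg_def sum_constant_scaleR)

lemma perm_avg_linear: "linear L \<Longrightarrow> L (perm_avg I f) = perm_avg I (\<lambda>g. L (f g))"
  by (simp add: perm_avg_def linear_scale linear_sum)

lemma perm_avg_add: "perm_avg I (\<lambda>g. f g + h g) = perm_avg I f + perm_avg I h"
  by (simp add: perm_avg_def sum.distrib scaleR_add_right)

lemma perm_avg_diff: "perm_avg I (\<lambda>g. f g - h g) = perm_avg I f - perm_avg I h"
  by (simp add: perm_avg_def sum_subtractf scaleR_diff_right)

lemma perm_avg_comp_left: "h permutes I \<Longrightarrow> perm_avg I (\<lambda>g. f (h \<circ> g)) = perm_avg I f"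
  unfolding perm_avg_def by (subst setum_permutations_compose_left[of h I f]) auto

text \<open>Only permutations satisfying \<open>P\<close> contribute, so the triangle inequality
  leaves their proportion as a factor. The seminorm \<open>q\<close> will be the operator norm in a
  representation.\<close>

lemma perm_avg_seminorm_le:
  fixes f :: "('j \<Rightarrow> 'j) \<Rightarrow> 'v::real_vector" and q :: "'v \<Rightarrow> real"
  assumes "q 0 = 0" and "\<And>x y. q (x + y) \<le> q x + q y" and "\<And>r x. q (r *\<^sub>R x) = \<bar>r\<bar> * q x"
    and "\<And>g. g permutes I \<Longrightarrow> q (f g) \<le> K"
    and "\<And>g. g permutes I \<Longrightarrow> \<not> P g \<Longrightarrow> f g = 0"
    and "finite I"
  shows "q (perm_avg I f) \<le> K * (card {g. g permutes I \<and> P g} / card {g. g permutes I})"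
proof -
  let ?B = "{g. g permutes I \<and> P g}"
  have fin: "finite {g. g permutes I}"
    using finite_permutations[OF assms(6)] .
  then have "q (sum f {g. g permutes I}) = q (sum f ?B)"
    using assms(5) by (intro arg_cong[of _ _ q] sum.mono_neutral_right) auto
  also have "\<dots> \<le> (\<Sum>g\<in>?B. q (f g))"
  proof -
    have "q (sum f B) \<le> (\<Sum>g\<in>B. q (f g))" for B
      by (induction B rule: infinite_finite_induct) (auto simp: assms(1) intro: order_trans[OF assms(2)])
    then show ?thesis .
  qed
  also have "\<dots> \<le> card ?B * K"
    using sum_bounded_above[of ?B "\<lambda>g. q (f g)" K] assms(4) by simp
  finally show ?thesis
    using assms(3) by (simp add: perm_avg_def divide_right_mono mult.commute)
qed

text \<open>Such a \<open>g\<close> is the transposition of \<open>s\<close> and \<open>k\<close>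
  after a permutation of \<open>I - {s}\<close>. With n elements in \<open>I\<close> there are at
  most (n-1)! of them, out of n!.\<close>

lemma card_permutes_maps_to_le:
  assumes "finite I" "s \<in> I"
  shows "card {g. g permutes I \<and> g s = k} * card I \<le> card {g. g permutes I}"
proof -
  define I' where "I' = I - {s}"
  have I: "I = insert s I'" "s \<notin> I'" "finite I'"
    using assms by (auto simp: I'_def)
  have "{g. g permutes I \<and> g s = k} \<subseteq> (\<lambda>p. Transposition.transpose s k \<circ> p) ` {p. p permutes I'}"
  proof
    fix g
    assume "g \<in> {g. g permutes I \<and> g s = k}"
    then have g: "g s = k" and "g \<in> {g. g permutes insert s I'}"
      using I(1) by auto
    then obtain b p where bp: "g = Transposition.transpose s b \<circ> p" "p permutes I'"
      unfolding permutes_insert by auto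
    with g have "b = k"
      using I(2) by (auto simp: permutes_not_in)
    then show "g \<in> (\<lambda>p. Transposition.transpose s k \<circ> p) ` {p. p permutes I'}"
      using bp by auto
  qed
  then have "card {g. g permutes I \<and> g s = k} \<le> card {p. p permutes I'}"
    by (intro surj_card_le finite_permutations I(3))
  also have "\<dots> = fact (card I')"
    by (rule card_permutations[OF refl I(3)])
  finally have "card {g. g permutes I \<and> g s = k} * card I \<le> fact (card I') * card I"
    by simp
  also have "\<dots> = fact (card I)"
    using I by simp
  also have "\<dots> = card {g. g permutes I}"
    using card_permutations[OF refl assms(1)] by simp
  finally show ?thesis .
qed

text \<open>Union bound over the pairs in \<open>S \<times> F\<close>: a random permutation sends
  \<open>s\<close> to \<open>k\<close> with probability at most \<open>1 / card I\<close>.\<close>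

lemma permutes_meeting_fraction_le:
  assumes "finite I" "I \<noteq> {}" "S \<subseteq> I" "finite F"
  shows "card {g. g permutes I \<and> g ` S \<inter> F \<noteq> {}} / card {g. g permutes I}
    \<le> real (card S) * real (card F) / real (card I)"
proof -
  have fin: "finite {g. g permutes I \<and> g s = k}" for s k
    using finite_permutations[OF assms(1)] by simp
  have S: "finite S"
    using assms finite_subset by blast
  have "{g. g permutes I \<and> g ` S \<inter> F \<noteq> {}} = (\<Union>(s, k)\<in>S \<times> F. {g. g permutes I \<and> g s = k})"
    by auto
  then have "card {g. g permutes I \<and> g ` S \<inter> F \<noteq> {}} * card I
    \<le> (\<Sum>(s, k)\<in>S \<times> F. card {g. g permutes I \<and> g s = k}) * card I"
    using card_UN_le[of "S \<times> F" "\<lambda>(s, k). {g. g permutes I \<and> g s = k}"] S assms(4)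
    by (simp add: case_prod_unfold)
  also have "\<dots> = (\<Sum>(s, k)\<in>S \<times> F. card {g. g permutes I \<and> g s = k} * card I)"
    by (simp add: sum_distrib_right case_prod_unfold)
  also have "\<dots> \<le> (\<Sum>(s, k)\<in>S \<times> F. card {g. g permutes I})"
    using assms card_permutes_maps_to_le[OF assms(1)] by (intro sum_mono) auto
  finally have "card {g. g permutes I \<and> g ` S \<inter> F \<noteq> {}} * card I
      \<le> card S * card F * card {g. g permutes I}"
    by (simp add: card_cartesian_product)
  then have "real (card {g. g permutes I \<and> g ` S \<inter> F \<noteq> {}}) * real (card I)
      \<le> real (card S) * real (card F) * real (card {g. g permutes I})"
    by (simp flip: of_nat_mult)
  moreover have "card I > 0" "card {g. g permutes I} > 0"
    using assms by (auto simp: card_gt_0_iff card_permutations[OF refl assms(1)])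
  ultimately show ?thesis
    by (simp add: field_simps)
qed

text \<open>Finite subsets of an infinite set eventually exceed every size. This makes the error
  terms of the counting estimates vanish.\<close>

lemma tendsto_const_div_card_finite_subsets:
  assumes "infinite J"
  shows "((\<lambda>I. c / real (card I)) \<longlongrightarrow> 0) (finite_subsets_at_top J)"
proof -
  have "filterlim card at_top (finite_subsets_at_top J)"
    unfolding filterlim_at_top
  proof
    fix n
    obtain X where "finite X" "X \<subseteq> J" "card X = n"
      using infinite_arbitrarily_large[OF assms] by metis
    then show "\<forall>\<^sub>F I in finite_subsets_at_top J. n \<le> card I"
      unfolding eventually_finite_subsets_at_top by (metis card_mono)
  qed
  then have "filterlim (\<lambda>I. real (card I)) at_top (finite_subsets_at_top J)"
    by (rule filterlim_compose[OF filterlim_real_sequentially])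
  then show ?thesis
    by (intro tendsto_divide_0[OF tendsto_const] filterlim_at_top_imp_at_infinity)
qed

lemma permutes_finitary: "finite I \<Longrightarrow> I \<subseteq> J \<Longrightarrow> g permutes I \<Longrightarrow> g \<in> finitary_permutations J"
  unfolding finitary_permutations_def
  by (auto intro: permutes_subset finite_subset[of _ I] simp: permutes_def)

section \<open>Representations of C*-algebras\<close>

lemma star_one: "star (1::'a::cstar_algebra) = 1"
  by (metis mult_1_right star_mult star_star)

lemma linear_scaleC_alg: "linear (\<lambda>x::'a::cstar_algebra. c *\<^sub>C x)"
  by (rule linearI) (simp add: scaleC_add_right, metis scaleC_of_real scaleC_scaleC mult.commute)

lemmas scaleC_diff_alg = linear_diff[OF linear_scaleC_alg]

lemma linear_star: "linear (star :: 'a::cstar_algebra \<Rightarrow> 'a)"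
  by (rule linearI)
    (simp add: star_add, metis scaleC_of_real star_scaleC complex_cnj_complex_of_real)

lemma norm_star: "norm (star x) = norm (x::'a::cstar_algebra)"
proof -
  have "norm x \<le> norm (star x)" for x :: 'a
  proof (cases "x = 0")
    case False
    have "norm x * norm x \<le> norm (star x) * norm x"
      using norm_mult_ineq[of "star x" x] by (simp add: cstar_identity power2_eq_square)
    with False show ?thesis
      by simp
  qed simp
  from this[of x] this[of "star x"] show ?thesis
    by (simp add: star_star)
qed

text \<open>For use in a representation, where a left inverse of \<open>1 - y\<close> makes the
  image of \<open>1 - y\<close> bounded below.\<close>

lemma neumann_series_left_inverse:
  fixes y :: "'a::{real_normed_algebra_1,banach}"
  assumes "norm y < 1"
  shows "(\<Sum>n. y ^ n) * (1 - y) = 1"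
proof -
  have s: "summable (\<lambda>n. y ^ n)"
    using complete_algebra_summable_geometric[OF assms] .
  have "(\<Sum>n. y ^ n) * y = (\<Sum>n. y ^ Suc n)"
    by (simp add: suminf_mult2[OF s] power_Suc2 del: power_Suc)
  also have "\<dots> = (\<Sum>n. y ^ n) - 1"
    using suminf_split_head[OF s] by simp
  finally show ?thesis
    by (simp add: algebra_simps)
qed

section \<open>Contractivity of representations and the operator seminorm\<close>

locale cstar_rep =
  fixes \<pi> :: "'a::cstar_algebra \<Rightarrow> 'h::chilbert_space \<Rightarrow> 'h"
  assumes rep: "star_representation \<pi>"
begin

lemma rep_bounded_clinear: "bounded_clinear (\<pi> A)"
  and rep_one: "\<pi> 1 = id"
  and rep_add: "\<pi> (A + B) x = \<pi> A x + \<pi> B x"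
  and rep_scaleC: "\<pi> (c *\<^sub>C A) x = c *\<^sub>C \<pi> A x"
  and rep_mult: "\<pi> (A * B) x = \<pi> A (\<pi> B x)"
  and rep_star: "cinner (\<pi> (star A) x) y = cinner x (\<pi> A y)"
  using rep by (auto simp: star_representation_def)

lemma rep_scaleR: "\<pi> (r *\<^sub>R A) x = r *\<^sub>R \<pi> A x"
  by (metis rep_scaleC scaleC_of_real)

lemma linear_rep: "linear (\<lambda>A. \<pi> A x)"
  by (rule linearI) (auto simp: rep_add rep_scaleR)

lemmas rep_bounded_linear = bounded_clinearD(1)[OF rep_bounded_clinear]
lemmas rep_clinear = bounded_clinearD(3-)[OF rep_bounded_clinear]
lemmas rep_diff = linear_diff[OF linear_rep]

lemma norm_rep_sq: "complex_of_real ((norm (\<pi> A x))\<^sup>2) = cinner (\<pi> (star A * A) x) x"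
  by (simp add: rep_mult rep_star cinner_self del: of_real_power)

lemma norm_rep_sq_Re: "(norm (\<pi> A x))\<^sup>2 = Re (cinner (\<pi> (star A * A) x) x)"
  by (simp flip: norm_rep_sq del: of_real_power)

text \<open>If \<open>N = \<parallel>\<pi> B\<parallel>\<close> exceeded \<open>\<parallel>B\<parallel>\<close>, then \<open>1 - B\<^sup>2 / N\<^sup>2\<close> would be invertible, so
  \<open>\<pi> (1 - B\<^sup>2 / N\<^sup>2)\<close> would be bounded below; but it is small on vectors at which \<open>\<pi> B\<close> nearly
  attains its norm.\<close>

lemma onorm_rep_self_adjoint_le:
  assumes B: "star B = B"
  shows "onorm (\<pi> B) \<le> norm B"
proof (rule ccontr)
  define N where "N = onorm (\<pi> B)"
  assume "\<not> onorm (\<pi> B) \<le> norm B"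
  then have N: "norm B < N" "0 < N"
    using norm_ge_zero[of B] by (auto simp: N_def simp del: norm_ge_zero)
  define y where "y = (1 / N\<^sup>2) *\<^sub>R (B * B)"
  have "norm y \<le> (norm B * norm B) / N\<^sup>2"
    by (simp add: y_def divide_right_mono norm_mult_ineq)
  also have "\<dots> < 1"
    using N mult_strict_mono[of "norm B" N "norm B" N] by (simp add: power2_eq_square)
  finally have y: "norm y < 1" .
  define S where "S = (\<Sum>n. y ^ n)"
  have S: "S * (1 - y) = 1"
    unfolding S_def by (rule neumann_series_left_inverse[OF y])
  \<comment> \<open>The added 1 gives \<open>K \<ge> 1\<close>, so that
    \<open>1 - 1 / K\<^sup>2\<close> is nonnegative under the root below.\<close>
  define K where "K = onorm (\<pi> S) + 1"
  have K: "K \<ge> 1"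
    by (simp add: K_def onorm_pos_le rep_bounded_linear)
  have "norm (\<pi> B x) \<le> N * sqrt (1 - 1 / K\<^sup>2) * norm x" for x
  proof -
    define w where "w = \<pi> B (\<pi> B x)"
    have y_x: "\<pi> (1 - y) x = x - (1 / N\<^sup>2) *\<^sub>R w"
      by (simp add: rep_diff rep_one y_def rep_scaleR rep_mult w_def)
    have "norm x = norm (\<pi> S (\<pi> (1 - y) x))"
      by (simp flip: rep_mult add: S rep_one)
    also have "\<dots> \<le> onorm (\<pi> S) * norm (\<pi> (1 - y) x)"
      by (rule onorm[OF rep_bounded_linear])
    also have "\<dots> \<le> K * norm (\<pi> (1 - y) x)"
      by (simp add: K_def mult_right_mono)
    finally have "(norm x)\<^sup>2 \<le> (K * norm (\<pi> (1 - y) x))\<^sup>2"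
      by (rule power_mono) simp
    also have "\<dots> = K\<^sup>2 * ((norm x)\<^sup>2 - 2 / N\<^sup>2 * Re (cinner x w) + (norm w)\<^sup>2 / N^4)"
      by (simp add: power_mult_distrib y_x norm_sq_diff cinner_scaleR_right power_divide
          flip: power_mult)
    also have "Re (cinner x w) = (norm (\<pi> B x))\<^sup>2"
      unfolding norm_rep_sq_Re B by (subst cinner_commute) (simp add: rep_mult w_def)
    also have "(norm x)\<^sup>2 - 2 / N\<^sup>2 * (norm (\<pi> B x))\<^sup>2 + (norm w)\<^sup>2 / N^4
        \<le> (norm x)\<^sup>2 - (norm (\<pi> B x))\<^sup>2 / N\<^sup>2"
    proof -
      have "norm w \<le> N * norm (\<pi> B x)"
        unfolding w_def N_def by (rule onorm[OF rep_bounded_linear])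
      then have "(norm w)\<^sup>2 \<le> N\<^sup>2 * (norm (\<pi> B x))\<^sup>2"
        by (metis norm_ge_zero power_mono power_mult_distrib)
      then have "(norm w)\<^sup>2 / N^4 \<le> (N\<^sup>2 * (norm (\<pi> B x))\<^sup>2) / N^4"
        by (simp add: divide_right_mono)
      also have "\<dots> = (norm (\<pi> B x))\<^sup>2 / N\<^sup>2"
        using N by (simp add: power4_eq_xxxx power2_eq_square)
      finally show ?thesis
        by simp
    qed
    finally have "(norm x)\<^sup>2 \<le> K\<^sup>2 * ((norm x)\<^sup>2 - (norm (\<pi> B x))\<^sup>2 / N\<^sup>2)"
      by (simp add: mult_left_mono)
    then have "(norm (\<pi> B x))\<^sup>2 \<le> N\<^sup>2 * (1 - 1 / K\<^sup>2) * (norm x)\<^sup>2"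
      using N K by (simp add: field_simps)
    also have "\<dots> = (N * sqrt (1 - 1 / K\<^sup>2) * norm x)\<^sup>2"
      using K by (simp add: power_mult_distrib)
    finally show ?thesis
      using K N by (intro power2_le_imp_le[of "norm (\<pi> B x)"]) auto
  qed
  \<comment> \<open>The bound holds at every vector, so the least bound \<open>N\<close> would be at
    most a strictly smaller multiple of itself.\<close>
  then have "N \<le> N * sqrt (1 - 1 / K\<^sup>2)"
    unfolding N_def[symmetric] using K N(2) by (subst N_def) (intro onorm_bound, auto)
  moreover have "sqrt (1 - 1 / K\<^sup>2) < 1"
    using K by simp
  ultimately show False
    using N(2) by simp
qed

text \<open>Estimates are made in the represented operator norm: unitary implementation bounds it
  under the action of permutations, and inner products give access to positivity.\<close>

definition repnorm :: "'a \<Rightarrow> real" where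
  "repnorm A = onorm (\<pi> A)"

lemma norm_rep_le: "norm (\<pi> A x) \<le> repnorm A * norm x"
  unfolding repnorm_def by (rule onorm[OF rep_bounded_linear])

lemma repnorm_leI: "0 \<le> K \<Longrightarrow> (\<And>x. norm (\<pi> A x) \<le> K * norm x) \<Longrightarrow> repnorm A \<le> K"
  unfolding repnorm_def by (rule onorm_bound)

lemma repnorm_nonneg: "0 \<le> repnorm A"
  by (simp add: repnorm_def onorm_pos_le rep_bounded_linear)

lemma repnorm_zero: "repnorm 0 = 0"
  using linear_0[OF linear_rep] repnorm_leI[of 0 0] repnorm_nonneg[of 0] by simp

lemma repnorm_add: "repnorm (A + B) \<le> repnorm A + repnorm B"
  unfolding repnorm_def rep_add by (rule onorm_triangle[OF rep_bounded_linear rep_bounded_linear])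

lemma repnorm_scaleR: "repnorm (r *\<^sub>R A) = \<bar>r\<bar> * repnorm A"
  unfolding repnorm_def rep_scaleR by (rule onorm_scaleR[OF rep_bounded_linear])

lemma repnorm_minus: "repnorm (- A) = repnorm A"
  using repnorm_scaleR[of "-1" A] by simp

lemma repnorm_diff: "repnorm (A - B) \<le> repnorm A + repnorm B"
  using repnorm_add[of A "- B"] by (simp add: repnorm_minus)

lemma repnorm_scaleC: "repnorm (c *\<^sub>C A) \<le> cmod c * repnorm A"
  by (rule repnorm_leI)
    (simp_all add: repnorm_nonneg rep_scaleC norm_scaleC norm_rep_le mult_left_mono mult.assoc)

lemma repnorm_mult: "repnorm (A * B) \<le> repnorm A * repnorm B"
proof (rule repnorm_leI)
  fix x
  have "norm (\<pi> A (\<pi> B x)) \<le> repnorm A * norm (\<pi> B x)"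
    by (rule norm_rep_le)
  also have "\<dots> \<le> repnorm A * (repnorm B * norm x)"
    by (intro mult_left_mono norm_rep_le repnorm_nonneg)
  finally show "norm (\<pi> (A * B) x) \<le> repnorm A * repnorm B * norm x"
    by (simp add: rep_mult mult.assoc)
qed (simp add: repnorm_nonneg)

lemma repnorm_anticommutator: "repnorm (A * B + B * A) \<le> 2 * (repnorm A * repnorm B)"
  using repnorm_add[of "A * B" "B * A"] repnorm_mult[of A B] repnorm_mult[of B A]
  by (simp add: mult.commute)

lemma repnorm_commutator: "repnorm (A * B - B * A) \<le> 2 * (repnorm A * repnorm B)"
  using repnorm_diff[of "A * B" "B * A"] repnorm_mult[of A B] repnorm_mult[of B A]
  by (simp add: mult.commute)

text \<open>The C*-identity reduces the claim to the self-adjoint element \<open>star A * A\<close>.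
  Contractivity lets approximation in norm carry over to \<open>repnorm\<close>.\<close>

lemma repnorm_le_norm: "repnorm A \<le> norm A"
proof (rule repnorm_leI)
  fix x
  have "(norm (\<pi> A x))\<^sup>2 \<le> cmod (cinner (\<pi> (star A * A) x) x)"
    unfolding norm_rep_sq_Re by (rule complex_Re_le_cmod)
  also have "\<dots> \<le> norm (\<pi> (star A * A) x) * norm x"
    by (rule norm_cinner_le)
  also have "\<dots> \<le> (norm A)\<^sup>2 * norm x * norm x"
  proof (rule mult_right_mono)
    have "repnorm (star A * A) \<le> (norm A)\<^sup>2"
      using onorm_rep_self_adjoint_le[of "star A * A"]
      by (simp add: star_mult star_star cstar_identity repnorm_def)
    then show "norm (\<pi> (star A * A) x) \<le> (norm A)\<^sup>2 * norm x"
      by (meson norm_rep_le mult_right_mono norm_ge_zero order_trans)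
  qed simp
  finally show "norm (\<pi> A x) \<le> norm A * norm x"
    by (intro power2_le_imp_le[of "norm (\<pi> A x)"]) (auto simp: power2_eq_square mult_ac)
qed simp

text \<open>The quadratic form of \<open>star C * C + C * star C\<close> at \<open>x\<close> is the
  sum of the squared norms of \<open>\<pi> C x\<close> and \<open>\<pi> (star C) x\<close>. Hence a
  small anticommutator with the adjoint forces \<open>C\<close> to be small.\<close>

lemma repnorm_sq_le: "(repnorm C)\<^sup>2 \<le> repnorm (star C * C + C * star C)"
proof -
  let ?q = "repnorm (star C * C + C * star C)"
  have "repnorm C \<le> sqrt ?q"
  proof (rule repnorm_leI)
    fix x
    have "(norm (\<pi> C x))\<^sup>2 \<le> (norm (\<pi> C x))\<^sup>2 + (norm (\<pi> (star C) x))\<^sup>2"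
      by simp
    also have "\<dots> = Re (cinner (\<pi> (star C * C + C * star C) x) x)"
      by (simp add: norm_rep_sq_Re star_star rep_add cinner_add_left)
    also have "\<dots> \<le> cmod (cinner (\<pi> (star C * C + C * star C) x) x)"
      by (rule complex_Re_le_cmod)
    also have "\<dots> \<le> norm (\<pi> (star C * C + C * star C) x) * norm x"
      by (rule norm_cinner_le)
    also have "\<dots> \<le> ?q * norm x * norm x"
      by (intro mult_right_mono norm_rep_le) simp
    also have "\<dots> = (sqrt ?q * norm x)\<^sup>2"
      by (simp add: power_mult_distrib repnorm_nonneg power2_eq_square)
    finally show "norm (\<pi> C x) \<le> sqrt ?q * norm x"
      by (rule power2_le_imp_le) (simp add: repnorm_nonneg)
  qed (simp add: repnorm_nonneg)
  then have "(repnorm C)\<^sup>2 \<le> (sqrt ?q)\<^sup>2"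
    by (rule power_mono) (rule repnorm_nonneg)
  then show ?thesis
    by (simp add: repnorm_nonneg)
qed

lemma rep_in_generated_vN_algebra: "\<pi> A \<in> generated_vN_algebra \<pi>"
  using rep_bounded_clinear by (auto simp: generated_vN_algebra_def commutant_def)

end

section \<open>Words in the generators of the CAR algebra\<close>

text \<open>A letter is an index with a flag for creators, so permutations act by
  \<open>apfst\<close> and the adjoint by \<open>apsnd Not\<close>.\<close>

definition car_gen :: "('j \<Rightarrow> 'a::cstar_algebra) \<Rightarrow> 'j \<times> bool \<Rightarrow> 'a" where
  "car_gen a x = (if snd x then star (a (fst x)) else a (fst x))"

definition car_word :: "('j \<Rightarrow> 'a::cstar_algebra) \<Rightarrow> ('j \<times> bool) list \<Rightarrow> 'a" where
  "car_word a l = prod_list (map (car_gen a) l)"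

lemma car_word_simps [simp]:
  "car_word a [] = 1" "car_word a (x # l) = car_gen a x * car_word a l"
  "car_word a (l @ m) = car_word a l * car_word a m"
  by (simp_all add: car_word_def)

lemma star_car_gen: "star (car_gen a x) = car_gen a (apsnd Not x)"
  by (cases x) (simp add: car_gen_def star_star)

lemma star_car_word: "star (car_word a l) = car_word a (rev (map (apsnd Not) l))"
  by (induction l) (simp_all add: star_one star_mult star_car_gen)

lemma car_gen_anticommute:
  assumes "car_algebra J a" "fst x \<in> J" "fst y \<in> J" "fst x \<noteq> fst y"
  shows "car_gen a x * car_gen a y = - (car_gen a y * car_gen a x)"
proof -
  have "star (a j) * a k + a k * star (a j) = 0" "a j * a k + a k * a j = 0"
    "star (a j) * star (a k) + star (a k) * star (a j) = 0" if "j \<in> J" "k \<in> J" "j \<noteq> k" for j k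
    using assms(1) that by (auto simp: car_algebra_def anticommutator_def)
  note ac = this[unfolded eq_neg_iff_add_eq_0[symmetric]]
  show ?thesis
    using ac[OF assms(2-4)] ac[OF assms(3,2) assms(4)[symmetric]] by (simp add: car_gen_def)
qed

lemma car_gen_word_commute:
  assumes "car_algebra J a" "fst x \<in> J"
  shows "fst ` set l \<subseteq> J \<Longrightarrow> fst x \<notin> fst ` set l \<Longrightarrow>
    car_gen a x * car_word a l = (-1) ^ length l *\<^sub>R (car_word a l * car_gen a x)"
proof (induction l)
  case (Cons y l)
  have "car_gen a x * car_word a (y # l) = - (car_gen a y * (car_gen a x * car_word a l))"
    using car_gen_anticommute[OF assms, of y] Cons.prems by (simp flip: mult.assoc)
  also have "car_gen a x * car_word a l = (-1) ^ length l *\<^sub>R (car_word a l * car_gen a x)"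
    using Cons by simp
  finally show ?case
    by (simp add: mult.assoc)
qed simp

text \<open>Each letter of \<open>m\<close> passes every letter of \<open>l\<close> at the cost of
  one sign. With disjoint supports two odd words anticommute, and an even word commutes with any
  word.\<close>

lemma car_word_commute:
  assumes "car_algebra J a" "fst ` set l \<subseteq> J"
  shows "fst ` set m \<subseteq> J \<Longrightarrow> fst ` set m \<inter> fst ` set l = {} \<Longrightarrow>
    car_word a m * car_word a l = (-1) ^ (length m * length l) *\<^sub>R (car_word a l * car_word a m)"
proof (induction m)
  case (Cons x m)
  have "car_word a (x # m) * car_word a l = car_gen a x * (car_word a m * car_word a l)"
    by (simp add: mult.assoc)
  also have "\<dots> = (-1) ^ (length m * length l) *\<^sub>R (car_gen a x * car_word a l * car_word a m)"
    using Cons by (simp add: mult.assoc)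
  also have "car_gen a x * car_word a l = (-1) ^ length l *\<^sub>R (car_word a l * car_gen a x)"
    using Cons.prems assms by (intro car_gen_word_commute) auto
  finally show ?case
    by (simp add: mult.assoc power_add)
qed simp

text \<open>The linear span of the words, set up so that induction reduces linear claims to single
  words.\<close>

inductive_set car_polynomials :: "'j set \<Rightarrow> ('j \<Rightarrow> 'a::cstar_algebra) \<Rightarrow> 'a set" for J a where
  word: "fst ` set l \<subseteq> J \<Longrightarrow> car_word a l \<in> car_polynomials J a"
| add: "x \<in> car_polynomials J a \<Longrightarrow> y \<in> car_polynomials J a \<Longrightarrow> x + y \<in> car_polynomials J a"
| scaleC: "x \<in> car_polynomials J a \<Longrightarrow> c *\<^sub>C x \<in> car_polynomials J a"

lemma car_polynomials_mult:
  assumes "x \<in> car_polynomials J a" "y \<in> car_polynomials J a"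
  shows "x * y \<in> car_polynomials J a"
  using assms(1)
proof induction
  case (word l)
  show ?case
    using assms(2)
  proof induction
    case (word m)
    with \<open>fst ` set l \<subseteq> J\<close> show ?case
      using car_polynomials.word[of "l @ m" J a] by (simp add: image_Un)
  qed (auto simp: distrib_left mult_scaleC_right intro: car_polynomials.intros)
qed (auto simp: distrib_right mult_scaleC_left intro: car_polynomials.intros)

lemma car_polynomials_star:
  assumes "x \<in> car_polynomials J a"
  shows "star x \<in> car_polynomials J a"
  using assms
proof induction
  case (word l)
  then show ?case
    unfolding star_car_word by (intro car_polynomials.word) (auto simp: image_image)
qed (auto simp: star_add star_scaleC intro: car_polynomials.intros)

section \<open>Density of the polynomials in the generators\<close>

lemma image_in_closure:
  assumes "continuous_on UNIV f" "\<And>x. x \<in> S \<Longrightarrow> f x \<in> T" "x \<in> closure S"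
  shows "f x \<in> closure T"
proof -
  have "f ` S \<subseteq> closure T"
    using assms(2) closure_subset[of T] by auto
  then have "f ` closure S \<subseteq> closure T"
    by (rule image_closure_subset[OF continuous_on_subset[OF assms(1) subset_UNIV] closed_closure])
  then show ?thesis
    using assms(3) by auto
qed

text \<open>The closure is a closed unital star-subalgebra containing the generators, so it contains
  their hull, which is everything.\<close>

lemma closure_car_polynomials:
  assumes "car_algebra J a"
  shows "closure (car_polynomials J a) = UNIV"
proof -
  let ?P = "car_polynomials J a"
  have gen: "car_gen a x \<in> ?P" if "fst x \<in> J" for x
    using car_polynomials.word[of "[x]" J a] that by simp
  have star: "star x \<in> closure ?P" if "x \<in> closure ?P" for x
  proof (rule image_in_closure[OF _ _ that])
    show "continuous_on UNIV (star :: 'b \<Rightarrow> 'b)"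
      by (intro linear_continuous_on bounded_linear_intro[of _ 1])
        (auto simp: norm_star linear_add[OF linear_star] linear_scale[OF linear_star])
  qed (auto intro: car_polynomials_star)
  have scale: "c *\<^sub>C x \<in> closure ?P" if "x \<in> closure ?P" for c x
  proof (rule image_in_closure[OF _ _ that])
    show "continuous_on UNIV (\<lambda>x::'b. c *\<^sub>C x)"
      by (intro linear_continuous_on bounded_linear_intro[of _ "cmod c"])
        (auto simp: norm_scaleC_alg linear_add[OF linear_scaleC_alg] linear_scale[OF linear_scaleC_alg])
  qed (auto intro: car_polynomials.intros)
  \<comment> \<open>Joint continuity on the product carries stability under a binary operation over
    to the closure; it is applied to sum and product.\<close>
  have lim: "f x y \<in> closure ?P"
    if c: "continuous_on UNIV (\<lambda>z. f (fst z) (snd z))" and f: "\<And>x y. x \<in> ?P \<Longrightarrow> y \<in> ?P \<Longrightarrow> f x y \<in> ?P"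
      and xy: "x \<in> closure ?P" "y \<in> closure ?P" for f :: "'b \<Rightarrow> 'b \<Rightarrow> 'b" and x y
  proof -
    have "(x, y) \<in> closure (?P \<times> ?P)"
      using xy by (simp add: closure_Times)
    then have "f (fst (x, y)) (snd (x, y)) \<in> closure ?P"
      by (rule image_in_closure[OF c, rotated]) (auto intro: f)
    then show ?thesis
      by simp
  qed
  have add: "x + y \<in> closure ?P" if "x \<in> closure ?P" "y \<in> closure ?P" for x y
    using that by (intro lim[of "(+)"] continuous_intros car_polynomials.add)
  have mult: "x * y \<in> closure ?P" if "x \<in> closure ?P" "y \<in> closure ?P" for x y
    using that by (intro lim[of "(*)"] continuous_intros car_polynomials_mult)
  have "1 \<in> ?P"
    using car_polynomials.word[of "[]" J a] by simp
  then have "unital_star_subalgebra (closure ?P)"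
    using closure_subset[of ?P] star scale add mult by (auto simp: unital_star_subalgebra_def)
  moreover have "a ` J \<union> (star \<circ> a) ` J \<subseteq> ?P"
    using gen[of "(_, False)"] gen[of "(_, True)"] by (auto simp: car_gen_def)
  then have "a ` J \<union> (star \<circ> a) ` J \<subseteq> closure ?P"
    using closure_subset[of ?P] by (rule subset_trans)
  ultimately have "(\<lambda>B. unital_star_subalgebra B \<and> closed B) hull (a ` J \<union> (star \<circ> a) ` J)
      \<subseteq> closure ?P"
    by (intro hull_minimal) auto
  then show ?thesis
    using assms by (auto simp: car_algebra_def)
qed

lemma star_automorphismD:
  assumes "star_automorphism f"
  shows "linear f" "f (x + y) = f x + f y" "f (c *\<^sub>C x) = c *\<^sub>C f x" "f (x * y) = f x * f y"
    "f (star x) = star (f x)" "f 1 = 1"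
proof -
  show f: "f (x + y) = f x + f y" "f (c *\<^sub>C x) = c *\<^sub>C f x" "f (x * y) = f x * f y"
    "f (star x) = star (f x)" for x y c
    using assms by (auto simp: star_automorphism_def)
  show "linear f"
    by (rule linearI) (simp add: f(1), metis f(2) scaleC_of_real)
  \<comment> \<open>Surjectivity yields unitality: \<open>f 1 * f e\<close> equals both
    \<open>f 1\<close> and \<open>f e\<close>.\<close>
  obtain e where "f e = 1"
    using assms by (metis bij_pointE star_automorphism_def)
  then show "f 1 = 1"
    by (metis f(3) mult_1_left mult_1_right)
qed

section \<open>The averages of an element of the CAR algebra\<close>

lemma eventually_finite_subsets_containing:
  assumes "finite X" "X \<subseteq> J"
  shows "\<forall>\<^sub>F I in finite_subsets_at_top J. finite I \<and> X \<subseteq> I \<and> I \<subseteq> J"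
  using assms by (auto simp: eventually_finite_subsets_at_top)

lemma tendsto_zero_squeeze:
  fixes f :: "'i \<Rightarrow> real"
  assumes "\<forall>\<^sub>F i in F. 0 \<le> f i" "\<forall>\<^sub>F i in F. f i \<le> g i" "(g \<longlongrightarrow> 0) F"
  shows "(f \<longlongrightarrow> 0) F"
  by (rule tendsto_sandwich[OF assms(1,2) tendsto_const assms(3)])

section \<open>Permutations in the GNS representation of a symmetric state\<close>

locale symmetric_gns = cstar_rep \<pi>
  for \<pi> :: "'a::cstar_algebra \<Rightarrow> 'h::chilbert_space \<Rightarrow> 'h" +
  fixes J :: "'j set" and a :: "'j \<Rightarrow> 'a" and \<alpha> :: "('j \<Rightarrow> 'j) \<Rightarrow> 'a \<Rightarrow> 'a"
    and \<Omega> :: 'h and U :: "('j \<Rightarrow> 'j) \<Rightarrow> 'h \<Rightarrow> 'h"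
  assumes infinite_J: "infinite J"
    and car: "car_algebra J a"
    and action: "car_permutation_action J a \<alpha>"
    and cyclic: "closure (range (\<lambda>A. \<pi> A \<Omega>)) = UNIV"
    and perm_rep: "gns_permutation_rep J \<alpha> \<pi> \<Omega> U"
begin

abbreviation net :: "'j set filter" where
  "net \<equiv> finite_subsets_at_top J"

text \<open>This is \<open>M\<^sub>I A\<close> of the overview, formed in the algebra so that
  commutators of words can be computed there.\<close>

definition sym_avg :: "'j set \<Rightarrow> 'a \<Rightarrow> 'a" where
  "sym_avg I A = perm_avg I (\<lambda>g. \<alpha> g A)"

lemma eventually_net: "\<forall>\<^sub>F I in net. finite I \<and> I \<subseteq> J"
  using eventually_finite_subsets_containing[of "{}" J] by simp

context
  fixes g
  assumes g: "g \<in> finitary_permutations J"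
begin

lemma alpha_automorphism: "star_automorphism (\<alpha> g)"
  using action g by (simp add: car_permutation_action_def)

lemmas alpha = star_automorphismD[OF alpha_automorphism]

lemma alpha_gen: "fst x \<in> J \<Longrightarrow> \<alpha> g (car_gen a x) = car_gen a (apfst g x)"
  using action g by (simp add: car_permutation_action_def car_gen_def alpha(5))

lemma alpha_word: "fst ` set l \<subseteq> J \<Longrightarrow> \<alpha> g (car_word a l) = car_word a (map (apfst g) l)"
  by (induction l) (simp_all add: alpha(4,6) alpha_gen)

lemma U_unitary: "unitary (U g)"
  and U_Omega: "U g \<Omega> = \<Omega>"
  using perm_rep g by (auto simp: gns_permutation_rep_def)

lemmas U = unitaryD[OF U_unitary]
lemmas U_clinear = bounded_clinearD[OF U(1)]

lemma rep_alpha: "\<pi> (\<alpha> g A) = U g \<circ> \<pi> A \<circ> inv (U g)"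
  using perm_rep g by (auto simp: gns_permutation_rep_def)

lemma rep_alpha_U: "\<pi> (\<alpha> g A) (U g x) = U g (\<pi> A x)"
  by (simp add: rep_alpha U)

lemma repnorm_alpha: "repnorm (\<alpha> g A) \<le> repnorm A"
proof (rule repnorm_leI[OF repnorm_nonneg])
  fix x
  have "norm (\<pi> (\<alpha> g A) x) = norm (\<pi> A (inv (U g) x))"
    by (simp add: rep_alpha U)
  also have "\<dots> \<le> repnorm A * norm (inv (U g) x)"
    by (rule norm_rep_le)
  also have "norm (inv (U g) x) = norm x"
    by (metis U(4,5))
  finally show "norm (\<pi> (\<alpha> g A) x) \<le> repnorm A * norm x" .
qed

end

lemma alpha_comp: "g \<in> finitary_permutations J \<Longrightarrow> h \<in> finitary_permutations J \<Longrightarrow>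
    \<alpha> (g \<circ> h) A = \<alpha> g (\<alpha> h A)"
  and U_comp: "g \<in> finitary_permutations J \<Longrightarrow> h \<in> finitary_permutations J \<Longrightarrow>
    U (g \<circ> h) x = U g (U h x)"
  using action perm_rep by (auto simp: car_permutation_action_def gns_permutation_rep_def)

context
  fixes I
  assumes I: "finite I" "I \<subseteq> J"
begin

lemmas finitary = permutes_finitary[OF I]

lemma repnorm_perm_avg_le:
  assumes "\<And>g. g permutes I \<Longrightarrow> repnorm (f g) \<le> K"
  shows "repnorm (perm_avg I f) \<le> K"
proof -
  have "card {g. g permutes I} \<noteq> 0"
    using card_permutations[OF refl I(1)] by simp
  then show ?thesis
    using perm_avg_seminorm_le[of repnorm I f K "\<lambda>_. True", OF repnorm_zero repnorm_add repnorm_scaleR assms] I(1)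
    by simp
qed

text \<open>Terms survive only when \<open>g\<close> moves a point of \<open>S\<close> into
  \<open>F\<close>, which happens for a proportion of order \<open>1 / card I\<close> of the
  permutations.\<close>

lemma repnorm_perm_avg_meeting_le:
  assumes "\<And>g. g permutes I \<Longrightarrow> repnorm (f g) \<le> K"
    and "\<And>g. g permutes I \<Longrightarrow> g ` S \<inter> F = {} \<Longrightarrow> f g = 0"
    and "I \<noteq> {}" "S \<subseteq> I" "finite F" "0 \<le> K"
  shows "repnorm (perm_avg I f) \<le> K * (real (card S) * real (card F)) / real (card I)"
proof -
  have "repnorm (perm_avg I f) \<le>
      K * (card {g. g permutes I \<and> g ` S \<inter> F \<noteq> {}} / card {g. g permutes I})"
    by (rule perm_avg_seminorm_le) (use assms I in \<open>auto simp: repnorm_zero repnorm_add repnorm_scaleR\<close>)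
  also have "\<dots> \<le> K * (real (card S) * real (card F) / real (card I))"
    by (intro mult_left_mono permutes_meeting_fraction_le assms I)
  finally show ?thesis
    by simp
qed

lemma repnorm_sym_avg_le: "repnorm (sym_avg I A) \<le> repnorm A"
  unfolding sym_avg_def by (intro repnorm_perm_avg_le repnorm_alpha finitary)

lemma sym_avg_add: "sym_avg I (A + B) = sym_avg I A + sym_avg I B"
  unfolding sym_avg_def perm_avg_add[symmetric] by (intro perm_avg_cong) (simp add: alpha finitary)

lemma sym_avg_scaleC: "sym_avg I (c *\<^sub>C A) = c *\<^sub>C sym_avg I A"
  unfolding sym_avg_def perm_avg_linear[OF linear_scaleC_alg]
  by (intro perm_avg_cong) (simp add: alpha finitary)

lemma sym_avg_diff: "sym_avg I (A - B) = sym_avg I A - sym_avg I B"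
  using sym_avg_add[of "A - B" B] by (simp add: algebra_simps)

lemma sym_avg_star: "sym_avg I (star A) = star (sym_avg I A)"
  unfolding sym_avg_def perm_avg_linear[OF linear_star]
  by (intro perm_avg_cong) (simp add: alpha finitary)

lemma sym_avg_mult_right: "sym_avg I A * B = perm_avg I (\<lambda>g. \<alpha> g A * B)"
  unfolding sym_avg_def
  by (rule perm_avg_linear[of "\<lambda>x. x * B"]) (auto intro: linearI simp: distrib_right)

lemma sym_avg_mult_left: "B * sym_avg I A = perm_avg I (\<lambda>g. B * \<alpha> g A)"
  unfolding sym_avg_def
  by (rule perm_avg_linear[of "\<lambda>x. B * x"]) (auto intro: linearI simp: distrib_left)

lemma sym_avg_commutator:
  "sym_avg I A * B - B * sym_avg I A = perm_avg I (\<lambda>g. \<alpha> g A * B - B * \<alpha> g A)"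
  by (simp add: sym_avg_mult_right sym_avg_mult_left perm_avg_diff)

lemma sym_avg_anticommutator:
  "sym_avg I A * B + B * sym_avg I A = perm_avg I (\<lambda>g. \<alpha> g A * B + B * \<alpha> g A)"
  by (simp add: sym_avg_mult_right sym_avg_mult_left perm_avg_add)

lemma rep_sym_avg: "\<pi> (sym_avg I A) x = perm_avg I (\<lambda>g. \<pi> (\<alpha> g A) x)"
  unfolding sym_avg_def by (rule perm_avg_linear[OF linear_rep])

text \<open>Left translation by \<open>h\<close> only reorders the summands.\<close>

lemma alpha_sym_avg: "h permutes I \<Longrightarrow> \<alpha> h (sym_avg I A) = sym_avg I A"
proof -
  assume h: "h permutes I"
  have "\<alpha> h (sym_avg I A) = perm_avg I (\<lambda>g. \<alpha> (h \<circ> g) A)"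
    unfolding sym_avg_def perm_avg_linear[OF alpha(1)[OF finitary[OF h]]]
    by (intro perm_avg_cong) (simp add: alpha_comp finitary h)
  then show ?thesis
    unfolding sym_avg_def perm_avg_comp_left[OF h, of "\<lambda>g. \<alpha> g A"] .
qed

end

text \<open>Two odd words anticommute unless their supports meet, and most pairs of permutations move a
  given support to disjoint places.\<close>

lemma sym_avg_odd_word_tendsto:
  assumes l: "fst ` set l \<subseteq> J" "odd (length l)"
  shows "((\<lambda>I. repnorm (sym_avg I (car_word a l))) \<longlongrightarrow> 0) net"
proof -
  define A where "A = car_word a l"
  define S where "S = fst ` set l"
  define l' where "l' = rev (map (apsnd Not) l)"
  have A': "star A = car_word a l'" "fst ` set l' = S" "length l' = length l"
    by (auto simp: A_def S_def l'_def star_car_word image_image)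
  have S: "finite S" "S \<subseteq> J"
    using l by (auto simp: S_def)
  define C where "C = 2 * (repnorm (star A) * repnorm A) * (real (card S) * real (card S))"
  \<comment> \<open>Adjoining \<open>j\<close> to \<open>S\<close> keeps \<open>I\<close> nonempty,
    as the counting estimate requires.\<close>
  obtain j where "j \<in> J"
    using infinite_J by (metis finite.emptyI equals0I)
  then have "\<forall>\<^sub>F I in net. finite I \<and> insert j S \<subseteq> I \<and> I \<subseteq> J"
    using S by (intro eventually_finite_subsets_containing) auto
  then have "\<forall>\<^sub>F I in net. (repnorm (sym_avg I A))\<^sup>2 \<le> C / real (card I)"
  proof eventually_elim
    case (elim I)
    then have I: "finite I" "I \<subseteq> J" "S \<subseteq> I" "I \<noteq> {}"
      by auto
    \<comment> \<open>With \<open>h\<close> fixed, averaging over \<open>g\<close> alone already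
      gives a small anticommutator, uniformly in \<open>h\<close>.\<close>
    have inner: "repnorm (perm_avg I (\<lambda>g. \<alpha> g (star A) * \<alpha> h A + \<alpha> h A * \<alpha> g (star A)))
        \<le> C / real (card I)"
      if h: "h permutes I" for h
    proof -
      have "repnorm (perm_avg I (\<lambda>g. \<alpha> g (star A) * \<alpha> h A + \<alpha> h A * \<alpha> g (star A)))
          \<le> 2 * (repnorm (star A) * repnorm A) * (real (card S) * real (card (h ` S))) / real (card I)"
      proof (rule repnorm_perm_avg_meeting_le[OF I(1,2)])
        fix g
        assume g: "g permutes I"
        note fin = finitary[OF I(1,2) g] finitary[OF I(1,2) h]
        have "repnorm (\<alpha> g (star A)) * repnorm (\<alpha> h A) \<le> repnorm (star A) * repnorm A"
          by (intro mult_mono repnorm_alpha fin repnorm_nonneg)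
        then show "repnorm (\<alpha> g (star A) * \<alpha> h A + \<alpha> h A * \<alpha> g (star A))
            \<le> 2 * (repnorm (star A) * repnorm A)"
          using repnorm_anticommutator[of "\<alpha> g (star A)" "\<alpha> h A"] by simp
        have img: "fst ` set (map (apfst f) m) = f ` fst ` set m" for f and m :: "('j \<times> bool) list"
          by (auto simp: image_image)
        have J: "g ` S \<subseteq> J" "h ` S \<subseteq> J"
          using I permutes_image[OF g] permutes_image[OF h] by blast+
        assume "g ` S \<inter> h ` S = {}"
        then have "car_word a (map (apfst g) l') * car_word a (map (apfst h) l)
            = (-1) ^ (length l * length l) *\<^sub>R
              (car_word a (map (apfst h) l) * car_word a (map (apfst g) l'))"
          using car_word_commute[OF car, of "map (apfst h) l" "map (apfst g) l'"] J
          by (simp only: img A' length_map) (simp add: S_def)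
        \<comment> \<open>The product of the two odd lengths is odd, so the sign is -1.\<close>
        then show "\<alpha> g (star A) * \<alpha> h A + \<alpha> h A * \<alpha> g (star A) = 0"
          using l S A'(2)
          by (simp add: A'(1)) (simp add: A_def alpha_word[OF fin(1)] alpha_word[OF fin(2)])
      qed (use I S in \<open>auto simp: repnorm_nonneg\<close>)
      also have "\<dots> \<le> C / real (card I)"
        unfolding C_def using card_image_le[OF S(1), of h]
        by (intro divide_right_mono mult_left_mono) (auto simp: repnorm_nonneg)
      finally show ?thesis .
    qed
    have "(repnorm (sym_avg I A))\<^sup>2
        \<le> repnorm (star (sym_avg I A) * sym_avg I A + sym_avg I A * star (sym_avg I A))"
      by (rule repnorm_sq_le)
    \<comment> \<open>Only one of the two averages is expanded; the other is what
      \<open>inner\<close> bounds for each \<open>h\<close>.\<close>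
    also have "star (sym_avg I A) * sym_avg I A + sym_avg I A * star (sym_avg I A)
        = perm_avg I (\<lambda>h. sym_avg I (star A) * \<alpha> h A + \<alpha> h A * sym_avg I (star A))"
      using sym_avg_anticommutator[OF I(1,2), of A "sym_avg I (star A)"]
      by (simp add: sym_avg_star[OF I(1,2)] add.commute)
    also have "repnorm \<dots> \<le> C / real (card I)"
      using inner by (intro repnorm_perm_avg_le I) (simp add: sym_avg_anticommutator I)
    finally show ?case .
  qed
  then have "((\<lambda>I. (repnorm (sym_avg I A))\<^sup>2) \<longlongrightarrow> 0) net"
    by (rule tendsto_zero_squeeze[rotated])
      (simp_all add: tendsto_const_div_card_finite_subsets infinite_J)
  then have "((\<lambda>I. sqrt ((repnorm (sym_avg I A))\<^sup>2)) \<longlongrightarrow> sqrt 0) net"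
    by (rule tendsto_real_sqrt)
  then show ?thesis
    by (simp add: repnorm_nonneg A_def)
qed

section \<open>Asymptotic centrality of the averages\<close>

abbreviation avg_commutator :: "'j set \<Rightarrow> 'a \<Rightarrow> 'a \<Rightarrow> 'a" where
  "avg_commutator I A B \<equiv> sym_avg I A * B - B * sym_avg I A"

definition asymp_commutes :: "'a \<Rightarrow> 'a \<Rightarrow> bool" where
  "asymp_commutes A B \<longleftrightarrow> ((\<lambda>I. repnorm (avg_commutator I A B)) \<longlongrightarrow> 0) net"

lemma asymp_commutesI:
  assumes "\<forall>\<^sub>F I in net. repnorm (avg_commutator I A B) \<le> f I" "(f \<longlongrightarrow> 0) net"
  shows "asymp_commutes A B"
  unfolding asymp_commutes_def
  by (rule tendsto_zero_squeeze[OF _ assms]) (simp add: repnorm_nonneg)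

text \<open>Averaging is contractive for \<open>repnorm\<close>, so approximating \<open>A\<close>
  and \<open>B\<close> in norm changes the commutator by an amount uniform in
  \<open>I\<close>.\<close>

lemma asymp_commutes_closure:
  assumes "(A, B) \<in> closure S" and "\<And>A B. (A, B) \<in> S \<Longrightarrow> asymp_commutes A B"
  shows "asymp_commutes A B"
  unfolding asymp_commutes_def tendsto_iff
proof (intro allI impI)
  fix e :: real
  assume e: "e > 0"
  \<comment> \<open>The bound 1 keeps the norm of \<open>B'\<close> at most
    \<open>norm B + 1\<close>; the other bound keeps the two error terms together strictly below
    \<open>e / 2\<close>.\<close>
  define r where "r = min 1 (e / (4 * (norm A + norm B + 2)))"
  have pos: "0 < 4 * (norm A + norm B + 2)"
    using norm_ge_zero[of A] norm_ge_zero[of B] by (simp del: norm_ge_zero)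
  then have r: "0 < r"
    using e by (simp add: r_def)
  then obtain A' B' where AB: "(A', B') \<in> S" "dist (A', B') (A, B) < r"
    using assms(1) unfolding closure_approachable by (metis surj_pair)
  have d: "norm (A - A') < r" "norm (B - B') < r"
    using AB(2) dist_fst_le[of "(A', B')" "(A, B)"] dist_snd_le[of "(A', B')" "(A, B)"]
    by (simp_all add: dist_norm norm_minus_commute)
  have pd: "repnorm (A - A') \<le> r" "repnorm (B - B') \<le> r"
    using d repnorm_le_norm[of "A - A'"] repnorm_le_norm[of "B - B'"] by simp_all
  have pB: "repnorm A \<le> norm A" "repnorm B' \<le> norm B + 1"
  proof -
    have "norm B' \<le> norm B + norm (B - B')"
      by (metis norm_triangle_sub norm_minus_commute)
    then show "repnorm B' \<le> norm B + 1"
      using d(2) repnorm_le_norm[of B'] by (simp add: r_def)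
  qed (rule repnorm_le_norm)
  have "\<forall>\<^sub>F I in net. dist (repnorm (avg_commutator I A' B')) 0 < e / 2"
    using assms(2)[OF AB(1)] e by (intro tendstoD) (auto simp: asymp_commutes_def)
  then show "\<forall>\<^sub>F I in net. dist (repnorm (avg_commutator I A B)) 0 < e"
    using eventually_net
  proof eventually_elim
    case (elim I)
    have "avg_commutator I A B = avg_commutator I A' B'
        + (avg_commutator I (A - A') B' + avg_commutator I A (B - B'))"
      using elim by (simp add: sym_avg_diff algebra_simps)
    then have "repnorm (avg_commutator I A B) \<le> repnorm (avg_commutator I A' B')
        + (repnorm (avg_commutator I (A - A') B') + repnorm (avg_commutator I A (B - B')))"
      by (simp only:) (intro order_trans[OF repnorm_add] add_left_mono repnorm_add)
    moreover have "repnorm (avg_commutator I (A - A') B') \<le> 2 * (r * (norm B + 1))"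
    proof -
      have "repnorm (sym_avg I (A - A')) * repnorm B' \<le> r * (norm B + 1)"
        using elim pd pB r order_trans[OF repnorm_sym_avg_le pd(1)]
        by (intro mult_mono) (auto simp: repnorm_nonneg)
      then show ?thesis
        using repnorm_commutator[of "sym_avg I (A - A')" B'] by simp
    qed
    moreover have "repnorm (avg_commutator I A (B - B')) \<le> 2 * (r * norm A)"
    proof -
      have "repnorm (sym_avg I A) * repnorm (B - B') \<le> norm A * r"
        using elim pd pB order_trans[OF repnorm_sym_avg_le pB(1)]
        by (intro mult_mono) (auto simp: repnorm_nonneg)
      then show ?thesis
        using repnorm_commutator[of "sym_avg I A" "B - B'"] by (simp add: mult.commute)
    qed
    moreover have "2 * (r * (norm B + 1)) + 2 * (r * norm A) < e / 2"
    proof -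
      have "r * (4 * (norm A + norm B + 2)) \<le> e"
        using pos min.cobounded2[of 1 "e / (4 * (norm A + norm B + 2))"]
        by (simp add: r_def flip: pos_le_divide_eq)
      then show ?thesis
        using r by (simp add: algebra_simps)
    qed
    ultimately show ?case
      using elim by (simp add: repnorm_nonneg)
  qed
qed

text \<open>An even word commutes with a letter off its support, and few permutations move its
  support onto that letter. An odd word has averages tending to 0, which makes any commutator with
  them vanish in the limit.\<close>

lemma asymp_commutes_word_gen:
  assumes l: "fst ` set l \<subseteq> J" and x: "fst x \<in> J"
  shows "asymp_commutes (car_word a l) (car_gen a x)"
proof (cases "even (length l)")
  case True
  define S where "S = fst ` set l"
  let ?A = "car_word a l" and ?B = "car_gen a x"
  have S: "finite S" "S \<subseteq> J"
    using l by (auto simp: S_def)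
  show ?thesis
  proof (rule asymp_commutesI)
    have "\<forall>\<^sub>F I in net. finite I \<and> insert (fst x) S \<subseteq> I \<and> I \<subseteq> J"
      using S x by (intro eventually_finite_subsets_containing) auto
    then show "\<forall>\<^sub>F I in net. repnorm (sym_avg I ?A * ?B - ?B * sym_avg I ?A)
        \<le> 2 * (repnorm ?A * repnorm ?B) * (real (card S) * real (card {fst x})) / real (card I)"
    proof eventually_elim
      case (elim I)
      then have I: "finite I" "I \<subseteq> J" "S \<subseteq> I" "I \<noteq> {}"
        by auto
      show ?case
        unfolding sym_avg_commutator[OF I(1,2)]
      proof (rule repnorm_perm_avg_meeting_le[OF I(1,2)])
        fix g
        assume g: "g permutes I"
        note fin = finitary[OF I(1,2) g]
        have "repnorm (\<alpha> g ?A) * repnorm ?B \<le> repnorm ?A * repnorm ?B"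
          by (intro mult_right_mono repnorm_alpha fin repnorm_nonneg)
        then show "repnorm (\<alpha> g ?A * ?B - ?B * \<alpha> g ?A) \<le> 2 * (repnorm ?A * repnorm ?B)"
          using repnorm_commutator[of "\<alpha> g ?A" ?B] by simp
        have img: "fst ` set (map (apfst g) l) = g ` S"
          by (auto simp: image_image S_def)
        have "g ` S \<subseteq> J"
          using I permutes_image[OF g] by blast
        moreover assume "g ` S \<inter> {fst x} = {}"
        ultimately have "?B * car_word a (map (apfst g) l) = car_word a (map (apfst g) l) * ?B"
          using car_gen_word_commute[OF car x, of "map (apfst g) l"] True
          by (simp add: img del: set_map)
        then show "\<alpha> g ?A * ?B - ?B * \<alpha> g ?A = 0"
          by (simp add: alpha_word[OF fin l])
      qed (use I in \<open>auto simp: repnorm_nonneg\<close>)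
    qed
  qed (rule tendsto_const_div_card_finite_subsets[OF infinite_J])
next
  case False
  show ?thesis
  proof (rule asymp_commutesI)
    show "\<forall>\<^sub>F I in net. repnorm (avg_commutator I (car_word a l) (car_gen a x))
        \<le> 2 * (repnorm (sym_avg I (car_word a l)) * repnorm (car_gen a x))"
      by (simp add: repnorm_commutator)
    show "((\<lambda>I. 2 * (repnorm (sym_avg I (car_word a l)) * repnorm (car_gen a x))) \<longlongrightarrow> 0) net"
      by (intro tendsto_mult_right_zero tendsto_mult_left_zero sym_avg_odd_word_tendsto l False)
  qed
qed

text \<open>The commutator with a fixed element is a derivation. This passes from letters to
  words.\<close>

lemma asymp_commutes_mult_right:
  assumes "asymp_commutes A B" "asymp_commutes A C"
  shows "asymp_commutes A (B * C)"
proof (rule asymp_commutesI)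
  show "\<forall>\<^sub>F I in net. repnorm (avg_commutator I A (B * C))
      \<le> repnorm (avg_commutator I A B) * repnorm C + repnorm B * repnorm (avg_commutator I A C)"
  proof
    fix I
    have "avg_commutator I A (B * C) = avg_commutator I A B * C + B * (avg_commutator I A C)"
      by (simp add: algebra_simps)
    then show "repnorm (avg_commutator I A (B * C))
        \<le> repnorm (avg_commutator I A B) * repnorm C + repnorm B * repnorm (avg_commutator I A C)"
      by (simp only:) (intro order_trans[OF repnorm_add] add_mono repnorm_mult)
  qed
  have "((\<lambda>I. repnorm (avg_commutator I A B) * repnorm C + repnorm B * repnorm (avg_commutator I A C))
      \<longlongrightarrow> 0 * repnorm C + repnorm B * 0) net"
    using assms unfolding asymp_commutes_def by (intro tendsto_intros)
  then show "((\<lambda>I. repnorm (avg_commutator I A B) * repnorm C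
      + repnorm B * repnorm (avg_commutator I A C)) \<longlongrightarrow> 0) net"
    by simp
qed

lemma asymp_commutes_one: "asymp_commutes A 1"
  by (simp add: asymp_commutes_def repnorm_zero)

lemma asymp_commutes_add_right:
  assumes "asymp_commutes A B" "asymp_commutes A C"
  shows "asymp_commutes A (B + C)"
proof (rule asymp_commutesI)
  show "\<forall>\<^sub>F I in net. repnorm (avg_commutator I A (B + C))
      \<le> repnorm (avg_commutator I A B) + repnorm (avg_commutator I A C)"
  proof
    fix I
    have "avg_commutator I A (B + C) = avg_commutator I A B + avg_commutator I A C"
      by (simp add: algebra_simps)
    then show "repnorm (avg_commutator I A (B + C))
        \<le> repnorm (avg_commutator I A B) + repnorm (avg_commutator I A C)"
      by (metis repnorm_add)
  qed
  show "((\<lambda>I. repnorm (avg_commutator I A B) + repnorm (avg_commutator I A C)) \<longlongrightarrow> 0) net"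
    using tendsto_add[OF assms[unfolded asymp_commutes_def]] by simp
qed

lemma asymp_commutes_scaleC_right:
  assumes "asymp_commutes A B"
  shows "asymp_commutes A (c *\<^sub>C B)"
proof (rule asymp_commutesI)
  show "\<forall>\<^sub>F I in net. repnorm (avg_commutator I A (c *\<^sub>C B))
      \<le> cmod c * repnorm (avg_commutator I A B)"
    using repnorm_scaleC by (simp add: mult_scaleC_left mult_scaleC_right flip: scaleC_diff_alg)
  show "((\<lambda>I. cmod c * repnorm (avg_commutator I A B)) \<longlongrightarrow> 0) net"
    using assms unfolding asymp_commutes_def by (rule tendsto_mult_right_zero)
qed

lemma asymp_commutes_add_left:
  assumes "asymp_commutes A B" "asymp_commutes A' B"
  shows "asymp_commutes (A + A') B"
proof (rule asymp_commutesI)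
  show "\<forall>\<^sub>F I in net. repnorm (avg_commutator I (A + A') B)
      \<le> repnorm (avg_commutator I A B) + repnorm (avg_commutator I A' B)"
    using eventually_net
  proof eventually_elim
    case (elim I)
    then have "avg_commutator I (A + A') B = avg_commutator I A B + avg_commutator I A' B"
      by (simp add: sym_avg_add algebra_simps)
    then show ?case
      by (metis repnorm_add)
  qed
  show "((\<lambda>I. repnorm (avg_commutator I A B) + repnorm (avg_commutator I A' B)) \<longlongrightarrow> 0) net"
    using tendsto_add[OF assms[unfolded asymp_commutes_def]] by simp
qed

lemma asymp_commutes_scaleC_left:
  assumes "asymp_commutes A B"
  shows "asymp_commutes (c *\<^sub>C A) B"
proof (rule asymp_commutesI)
  show "\<forall>\<^sub>F I in net. repnorm (avg_commutator I (c *\<^sub>C A) B)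
      \<le> cmod c * repnorm (avg_commutator I A B)"
    using eventually_net repnorm_scaleC
    by (auto elim!: eventually_mono
        simp: sym_avg_scaleC mult_scaleC_left mult_scaleC_right simp flip: scaleC_diff_alg)
  show "((\<lambda>I. cmod c * repnorm (avg_commutator I A B)) \<longlongrightarrow> 0) net"
    using assms unfolding asymp_commutes_def by (rule tendsto_mult_right_zero)
qed

text \<open>Density reduces both arguments to polynomials, linearity to words, and the derivation
  rule to one letter on the right.\<close>

lemma asymp_commutes: "asymp_commutes A B"
proof (rule asymp_commutes_closure[where S = "car_polynomials J a \<times> car_polynomials J a"])
  show "(A, B) \<in> closure (car_polynomials J a \<times> car_polynomials J a)"
    by (simp add: closure_Times closure_car_polynomials[OF car])
  fix A B
  assume "(A, B) \<in> car_polynomials J a \<times> car_polynomials J a"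
  then have "B \<in> car_polynomials J a" "A \<in> car_polynomials J a"
    by auto
  then show "asymp_commutes A B"
  proof induction
    case (word m)
    from \<open>A \<in> car_polynomials J a\<close> show ?case
    proof induction
      case (word l)
      from \<open>fst ` set m \<subseteq> J\<close> show ?case
      proof (induction m)
        case (Cons x m)
        then show ?case
          using asymp_commutes_word_gen[OF word, of x] by (simp add: asymp_commutes_mult_right)
      qed (simp add: asymp_commutes_one)
    qed (auto intro: asymp_commutes_add_left asymp_commutes_scaleC_left)
  qed (auto intro: asymp_commutes_add_right asymp_commutes_scaleC_right)
qed

section \<open>The strong limit of the averages\<close>

text \<open>Since \<open>U g\<close> fixes \<open>\<Omega>\<close>, the operator average at
  \<open>\<Omega>\<close> is an orbit average, to which the mean ergodic theorem applies.\<close>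

lemma rep_sym_avg_Omega:
  assumes "finite I" "I \<subseteq> J"
  shows "\<pi> (sym_avg I A) \<Omega> = perm_avg I (\<lambda>g. U g (\<pi> A \<Omega>))"
  unfolding rep_sym_avg[OF assms]
proof (rule perm_avg_cong)
  fix g
  assume "g permutes I"
  note fin = finitary[OF assms this]
  show "\<pi> (\<alpha> g A) \<Omega> = U g (\<pi> A \<Omega>)"
    using rep_alpha_U[OF fin, of A \<Omega>] by (simp add: U_Omega[OF fin])
qed

text \<open>\<open>perm_avg I (\<lambda>g. U g x)\<close> is the projection of \<open>x\<close> onto the \<open>\<bbbP>\<^sub>I\<close>-invariant vectors, so it
  is tested against such a vector by \<open>x\<close> itself.\<close>

lemma mean_ergodic: "\<exists>l. ((\<lambda>I. perm_avg I (\<lambda>g. U g x)) \<longlongrightarrow> l) net"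
proof (rule nested_projection_net_converges)
  fix I I'
  assume I': "finite I'" "I' \<subseteq> J" and sub: "I \<subseteq> I'"
  define E where "E I = perm_avg I (\<lambda>g. U g x)" for I
  have inv: "U h (E I') = E I'" if "h permutes I'" for h
  proof -
    note fin = finitary[OF I']
    have "U h (E I') = perm_avg I' (\<lambda>g. U (h \<circ> g) x)"
      unfolding E_def perm_avg_linear[OF U_clinear(2)[OF fin[OF that]]]
      by (intro perm_avg_cong) (simp add: U_comp fin that)
    also have "\<dots> = E I'"
      unfolding E_def by (rule perm_avg_comp_left[OF that, of "\<lambda>g. U g x"])
    finally show ?thesis .
  qed
  have test: "cinner (E K) (E I') = cinner x (E I')" if "K \<subseteq> I'" for K
  proof -
    have "cinner (E K) (E I') = perm_avg K (\<lambda>g. cinner (U g x) (E I'))"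
      unfolding E_def[of K]
      by (rule perm_avg_linear[OF bounded_linear.linear[OF bounded_linear_cinner_left]])
    also have "\<dots> = perm_avg K (\<lambda>_. cinner x (E I'))"
    proof (rule perm_avg_cong)
      fix g
      assume "g permutes K"
      then have g: "g permutes I'"
        using that permutes_subset by blast
      show "cinner (U g x) (E I') = cinner x (E I')"
        using U(3)[OF finitary[OF I' g], of x "E I'"] inv[OF g] by simp
    qed
    also have "\<dots> = cinner x (E I')"
      using finite_subset[OF that I'(1)] by (rule perm_avg_const)
    finally show ?thesis .
  qed
  \<comment> \<open>Testing both \<open>E I\<close> and \<open>E I'\<close> against
    \<open>E I'\<close> gives the same value, which is the orthogonality behind Pythagoras.\<close>
  have "cinner (E I) (E I') = complex_of_real ((norm (E I'))\<^sup>2)"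
    using test[OF sub] test[of I'] by (simp add: cinner_self del: of_real_power)
  then have "Re (cinner (E I) (E I')) = (norm (E I'))\<^sup>2"
    by simp
  then show "(norm (perm_avg I (\<lambda>g. U g x) - perm_avg I' (\<lambda>g. U g x)))\<^sup>2
      = (norm (perm_avg I (\<lambda>g. U g x)))\<^sup>2 - (norm (perm_avg I' (\<lambda>g. U g x)))\<^sup>2"
    using norm_sq_diff[of "E I" "E I'"] by (simp add: E_def)
qed

lemma rep_commutator_tendsto:
  "((\<lambda>I. \<pi> (sym_avg I A) (\<pi> B x) - \<pi> B (\<pi> (sym_avg I A) x)) \<longlongrightarrow> 0) net"
proof (rule Lim_null_comparison)
  show "\<forall>\<^sub>F I in net. norm (\<pi> (sym_avg I A) (\<pi> B x) - \<pi> B (\<pi> (sym_avg I A) x))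
      \<le> repnorm (avg_commutator I A B) * norm x"
    using norm_rep_le[of "sym_avg _ A * B - B * sym_avg _ A" x] by (simp add: rep_diff rep_mult)
  show "((\<lambda>I. repnorm (avg_commutator I A B) * norm x) \<longlongrightarrow> 0) net"
    using asymp_commutes[of A B] unfolding asymp_commutes_def by (rule tendsto_mult_left_zero)
qed

text \<open>\<open>Lim\<close> is a choice whose value has meaning only once convergence is known,
  which \<open>sym_lim_tendsto\<close> supplies.\<close>

definition sym_lim :: "'a \<Rightarrow> 'h \<Rightarrow> 'h" where
  "sym_lim A x = Lim net (\<lambda>I. \<pi> (sym_avg I A) x)"

lemma norm_rerepnorm_sym_avg_le:
  assumes "finite I" "I \<subseteq> J"
  shows "norm (\<pi> (sym_avg I A) x) \<le> repnorm A * norm x"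
  by (rule order_trans[OF norm_rep_le mult_right_mono[OF repnorm_sym_avg_le[OF assms]]]) simp

lemma sym_lim_tendsto: "((\<lambda>I. \<pi> (sym_avg I A) x) \<longlongrightarrow> sym_lim A x) net"
proof -
  have "\<exists>l. ((\<lambda>I. \<pi> (sym_avg I A) x) \<longlongrightarrow> l) net"
  proof (rule equibounded_net_converges[OF _ _ _ _ cyclic])
    show "\<forall>\<^sub>F I in net. \<forall>x. norm (\<pi> (sym_avg I A) x) \<le> repnorm A * norm x"
      using eventually_net by eventually_elim (simp add: norm_rerepnorm_sym_avg_le)
    fix d
    assume "d \<in> range (\<lambda>B. \<pi> B \<Omega>)"
    then obtain B where d: "d = \<pi> B \<Omega>"
      by auto
    obtain l where l: "((\<lambda>I. perm_avg I (\<lambda>g. U g (\<pi> A \<Omega>))) \<longlongrightarrow> l) net"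
      using mean_ergodic by blast
    moreover have "\<forall>\<^sub>F I in net. perm_avg I (\<lambda>g. U g (\<pi> A \<Omega>)) = \<pi> (sym_avg I A) \<Omega>"
      using eventually_net by eventually_elim (simp add: rep_sym_avg_Omega)
    ultimately have "((\<lambda>I. \<pi> (sym_avg I A) \<Omega>) \<longlongrightarrow> l) net"
      by (rule Lim_transform_eventually)
    then have "((\<lambda>I. \<pi> B (\<pi> (sym_avg I A) \<Omega>)) \<longlongrightarrow> \<pi> B l) net"
      by (rule bounded_linear.tendsto[OF rep_bounded_linear])
    \<comment> \<open>The average at \<open>\<pi> B \<Omega>\<close> is a vanishing commutator term
      plus \<open>\<pi> B\<close> applied to the convergent averages at
      \<open>\<Omega>\<close>.\<close>
    from tendsto_add[OF rep_commutator_tendsto[of A B \<Omega>] this]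
    show "\<exists>l. ((\<lambda>I. \<pi> (sym_avg I A) d) \<longlongrightarrow> l) net"
      by (auto simp: d)
  qed (simp_all add: bounded_clinearD(2)[OF rep_bounded_clinear])
  then show ?thesis
    unfolding sym_lim_def by (metis finite_subsets_at_top_neq_bot tendsto_Lim)
qed

section \<open>The limit operator and its place in the invariant center\<close>

lemma sym_lim_eqI:
  assumes "(f \<longlongrightarrow> y) net" "\<And>I. finite I \<Longrightarrow> I \<subseteq> J \<Longrightarrow> f I = \<pi> (sym_avg I A) x"
  shows "sym_lim A x = y"
proof -
  have "\<forall>\<^sub>F I in net. f I = \<pi> (sym_avg I A) x"
    using eventually_net by eventually_elim (simp add: assms(2))
  with assms(1) have "((\<lambda>I. \<pi> (sym_avg I A) x) \<longlongrightarrow> y) net"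
    by (rule Lim_transform_eventually)
  then show ?thesis
    using tendsto_unique[OF finite_subsets_at_top_neq_bot sym_lim_tendsto] by blast
qed

lemma sym_lim_add: "sym_lim (A + B) x = sym_lim A x + sym_lim B x"
  by (rule sym_lim_eqI[OF tendsto_add[OF sym_lim_tendsto sym_lim_tendsto]])
    (simp add: sym_avg_add rep_add)

lemma sym_lim_scaleC: "sym_lim (c *\<^sub>C A) x = c *\<^sub>C sym_lim A x"
  by (rule sym_lim_eqI[OF bounded_linear.tendsto[OF bounded_linear_scaleC sym_lim_tendsto]])
    (simp add: sym_avg_scaleC rep_scaleC)

lemma sym_lim_commute:
  assumes "bounded_linear T" "\<And>I. finite I \<Longrightarrow> I \<subseteq> J \<Longrightarrow> T (\<pi> (sym_avg I A) x) = \<pi> (sym_avg I A) (T x)"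
  shows "T (sym_lim A x) = sym_lim A (T x)"
  by (rule sym_lim_eqI[symmetric, OF bounded_linear.tendsto[OF assms(1) sym_lim_tendsto] assms(2)])

lemma sym_lim_bounded_clinear: "bounded_clinear (sym_lim A)"
proof -
  have scaleC: "sym_lim A (c *\<^sub>C x) = c *\<^sub>C sym_lim A x" for c x
    by (rule sym_lim_commute[symmetric, OF bounded_linear_scaleC]) (simp add: rep_clinear)
  have "norm (sym_lim A x) \<le> repnorm A * norm x" for x
  proof (rule tendsto_upperbound[OF tendsto_norm[OF sym_lim_tendsto]])
    show "\<forall>\<^sub>F I in net. norm (\<pi> (sym_avg I A) x) \<le> repnorm A * norm x"
      using eventually_net by eventually_elim (simp add: norm_rerepnorm_sym_avg_le)
  qed simp
  moreover have "sym_lim A (x + y) = sym_lim A x + sym_lim A y" for x y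
    by (rule sym_lim_eqI[OF tendsto_add[OF sym_lim_tendsto sym_lim_tendsto]])
      (simp add: rep_clinear)
  ultimately have "bounded_linear (sym_lim A)"
    using scaleC[of "complex_of_real _"]
    by (intro bounded_linear_intro[of _ "repnorm A"]) (auto simp: scaleC_of_real mult.commute)
  with scaleC show ?thesis
    by (simp add: bounded_clinear_def)
qed

text \<open>Asymptotic centrality becomes exact commutation in the strong limit.\<close>

lemma sym_lim_rep_commute: "sym_lim A (\<pi> B x) = \<pi> B (sym_lim A x)"
proof (rule sym_lim_eqI)
  show "((\<lambda>I. (\<pi> (sym_avg I A) (\<pi> B x) - \<pi> B (\<pi> (sym_avg I A) x)) + \<pi> B (\<pi> (sym_avg I A) x))
      \<longlongrightarrow> \<pi> B (sym_lim A x)) net"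
    using tendsto_add[OF rep_commutator_tendsto[of A B x]
        bounded_linear.tendsto[OF rep_bounded_linear sym_lim_tendsto, of B A x]]
    by (simp only: add_0_left)
qed simp

text \<open>Once \<open>I\<close> contains the support of \<open>h\<close>, the permutation
  \<open>h\<close> belongs to the group averaged over and fixes the average.\<close>

lemma U_L_commute:
  assumes h: "h \<in> finitary_permutations J"
  shows "U h (sym_lim A x) = sym_lim A (U h x)"
proof -
  have supp: "finite {j. h j \<noteq> j}" "{j. h j \<noteq> j} \<subseteq> J" and "h permutes J"
    using h by (auto simp: finitary_permutations_def permutes_def)
  have eq: "\<forall>\<^sub>F I in net. U h (\<pi> (sym_avg I A) x) = \<pi> (sym_avg I A) (U h x)"
    using eventually_finite_subsets_containing[OF supp]
  proof eventually_elim
    case (elim I)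
    then have "h permutes I"
      by (intro permutes_superset[OF \<open>h permutes J\<close>]) auto
    then show ?case
      using rep_alpha_U[OF h, of "sym_avg I A" x] elim by (simp add: alpha_sym_avg)
  qed
  have "((\<lambda>I. U h (\<pi> (sym_avg I A) x)) \<longlongrightarrow> U h (sym_lim A x)) net"
    by (rule bounded_linear.tendsto[OF U_clinear(1)[OF h] sym_lim_tendsto])
  from Lim_transform_eventually[OF this eq] show ?thesis
    using tendsto_unique[OF finite_subsets_at_top_neq_bot sym_lim_tendsto] by metis
qed

text \<open>Commutation with a bounded operator survives strong limits, so the limit of represented
  elements stays in the double commutant.\<close>

lemma sym_lim_in_invariant_center: "sym_lim A \<in> invariant_center J \<pi> U"
proof -
  have "sym_lim A \<in> generated_vN_algebra \<pi>"
    unfolding generated_vN_algebra_def commutant_def[of "commutant (range \<pi>)"]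
  proof (clarsimp simp: sym_lim_bounded_clinear fun_eq_iff)
    fix T x
    assume T: "T \<in> commutant (range \<pi>)"
    then have "T (\<pi> B y) = \<pi> B (T y)" for B y
      by (auto simp: commutant_def fun_eq_iff)
    then show "sym_lim A (T x) = T (sym_lim A x)"
      using T by (intro sym_lim_commute[symmetric]) (auto simp: commutant_def bounded_clinear_def)
  qed
  moreover have "sym_lim A \<in> commutant (range \<pi>)"
    by (auto simp: commutant_def sym_lim_bounded_clinear fun_eq_iff sym_lim_rep_commute)
  moreover have "U g \<circ> sym_lim A \<circ> inv (U g) = sym_lim A" if "g \<in> finitary_permutations J" for g
    using that by (simp add: fun_eq_iff U_L_commute U(5))
  ultimately show ?thesis
    by (simp add: invariant_center_def rep_center_def)
qed

lemma sym_lim_symmetric: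
  assumes "star A = A"
  shows "cinner (sym_lim A x) y = cinner x (sym_lim A y)"
proof -
  have "((\<lambda>I. cinner (\<pi> (sym_avg I A) x) y) \<longlongrightarrow> cinner (sym_lim A x) y) net"
    by (intro tendsto_cinner sym_lim_tendsto tendsto_const)
  moreover have "\<forall>\<^sub>F I in net. cinner (\<pi> (sym_avg I A) x) y = cinner x (\<pi> (sym_avg I A) y)"
    using eventually_net
  proof eventually_elim
    case (elim I)
    then show ?case
      using rep_star[of "sym_avg I A" x y] sym_avg_star[of I A] assms by simp
  qed
  ultimately have "((\<lambda>I. cinner x (\<pi> (sym_avg I A) y)) \<longlongrightarrow> cinner (sym_lim A x) y) net"
    by (rule Lim_transform_eventually)
  moreover have "((\<lambda>I. cinner x (\<pi> (sym_avg I A) y)) \<longlongrightarrow> cinner x (sym_lim A y)) net"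
    by (intro tendsto_cinner sym_lim_tendsto tendsto_const)
  ultimately show ?thesis
    using tendsto_unique[OF finite_subsets_at_top_neq_bot] by metis
qed

section \<open>Identification of the limit with the conditional expectation\<close>

lemma invariant_centerD:
  assumes "Z \<in> invariant_center J \<pi> U"
  shows "bounded_clinear Z" "Z (\<pi> A x) = \<pi> A (Z x)"
    "g \<in> finitary_permutations J \<Longrightarrow> U g (Z x) = Z (U g x)"
    "Z \<in> generated_vN_algebra \<pi>" "Z \<circ> \<pi> A \<in> generated_vN_algebra \<pi>"
proof -
  show Z: "bounded_clinear Z" and c: "Z (\<pi> A x) = \<pi> A (Z x)" and
    vN: "Z \<in> generated_vN_algebra \<pi>" for A x
    using assms by (auto simp: invariant_center_def rep_center_def commutant_def fun_eq_iff)
  show "U g (Z x) = Z (U g x)" if "g \<in> finitary_permutations J"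
  proof -
    have "U g (Z (inv (U g) (U g x))) = Z (U g x)"
      using assms that by (auto simp: invariant_center_def fun_eq_iff)
    then show ?thesis
      by (simp add: U(6)[OF that])
  qed
  have "bounded_clinear (Z \<circ> \<pi> A)"
    using Z rep_bounded_clinear[of A] bounded_linear_compose[of Z "\<pi> A"]
    by (simp add: bounded_clinear_def o_def)
  then show "Z \<circ> \<pi> A \<in> generated_vN_algebra \<pi>"
    using vN rep_in_generated_vN_algebra[of A]
    by (simp add: generated_vN_algebra_def commutant_def[of "commutant _"] fun_eq_iff)
qed

text \<open>Gives \<open>\<Phi> id = id\<close>, and lets a one-sided module rule be read off the
  two-sided one.\<close>

lemma id_in_invariant_center: "id \<in> invariant_center J \<pi> U"
  using rep_in_generated_vN_algebra[of 1]
  by (auto simp: invariant_center_def rep_center_def rep_one commutant_def[of "range _"]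
      bounded_clinear_id fun_eq_iff U(5))

lemma invariant_center_diff:
  assumes Z: "Z \<in> invariant_center J \<pi> U" and W: "W \<in> invariant_center J \<pi> U"
  shows "(\<lambda>x. Z x - W x) \<in> invariant_center J \<pi> U"
proof -
  note Z' = invariant_centerD[OF Z] and W' = invariant_centerD[OF W]
  have b: "bounded_clinear (\<lambda>x. Z x - W x)"
    by (rule bounded_clinear_diff[OF Z'(1) W'(1)])
  have "(\<lambda>x. Z x - W x) \<in> generated_vN_algebra \<pi>"
    using Z'(4) W'(4) b
    by (auto simp: generated_vN_algebra_def commutant_def[of "commutant _"] fun_eq_iff)
      (simp add: commutant_def bounded_clinearD(4))
  then show ?thesis
    by (auto simp: invariant_center_def rep_center_def commutant_def b fun_eq_iff Z'(2) W'(2)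
        rep_clinear U_clinear Z'(3) W'(3) U(5))
qed

text \<open>A bounded operator commuting with the representation is determined by its value at the
  cyclic vector, so \<open>\<Omega>\<close> separates the invariant center.\<close>

lemma vanishes_if_vanishes_at_Omega:
  assumes "Z \<in> invariant_center J \<pi> U" "Z \<Omega> = 0"
  shows "Z x = 0"
proof -
  note Z = invariant_centerD[OF assms(1)]
  have "Z y \<in> closure {0}" if "y \<in> closure (range (\<lambda>A. \<pi> A \<Omega>))" for y
  proof (rule image_in_closure[OF _ _ that])
    show "continuous_on UNIV Z"
      by (intro linear_continuous_on bounded_clinearD(1) Z(1))
  qed (auto simp: Z(2) assms(2) linear_0[OF bounded_clinearD(2)[OF rep_bounded_clinear]])
  then show ?thesis
    by (simp add: cyclic)
qed

text \<open>\<open>Z\<close> commutes with the unitaries \<open>U g\<close>, which fix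
  \<open>\<Omega>\<close>; hence all summands of the average have the same expectation and the net
  of expectations is eventually constant.\<close>

lemma vector_state_sym_lim:
  assumes Z: "Z \<in> invariant_center J \<pi> U"
  shows "cinner (Z (sym_lim A \<Omega>)) \<Omega> = cinner (Z (\<pi> A \<Omega>)) \<Omega>"
proof -
  note Z' = invariant_centerD[OF Z]
  have lin: "bounded_linear (\<lambda>x. cinner (Z x) \<Omega>)"
    using bounded_linear_compose[OF bounded_linear_cinner_left bounded_clinearD(1)[OF Z'(1)]] .
  have "\<forall>\<^sub>F I in net. cinner (Z (\<pi> (sym_avg I A) \<Omega>)) \<Omega> = cinner (Z (\<pi> A \<Omega>)) \<Omega>"
    using eventually_net
  proof eventually_elim
    case (elim I)
    then have I: "finite I" "I \<subseteq> J"
      by auto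
    have "cinner (Z (\<pi> (sym_avg I A) \<Omega>)) \<Omega> = perm_avg I (\<lambda>g. cinner (Z (U g (\<pi> A \<Omega>))) \<Omega>)"
      unfolding rep_sym_avg_Omega[OF I] by (rule perm_avg_linear[OF bounded_linear.linear[OF lin]])
    also have "\<dots> = perm_avg I (\<lambda>_. cinner (Z (\<pi> A \<Omega>)) \<Omega>)"
    proof (rule perm_avg_cong)
      fix g
      assume "g permutes I"
      note fin = finitary[OF I this]
      show "cinner (Z (U g (\<pi> A \<Omega>))) \<Omega> = cinner (Z (\<pi> A \<Omega>)) \<Omega>"
        using U(3)[OF fin, of "Z (\<pi> A \<Omega>)" \<Omega>] by (simp add: U_Omega[OF fin] Z'(3)[OF fin])
    qed
    finally show ?case
      by (simp add: perm_avg_const I)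
  qed
  with bounded_linear.tendsto[OF lin sym_lim_tendsto[of A \<Omega>]]
  have "((\<lambda>I. cinner (Z (\<pi> A \<Omega>)) \<Omega>) \<longlongrightarrow> cinner (Z (sym_lim A \<Omega>)) \<Omega>) net"
    by (rule Lim_transform_eventually)
  then show ?thesis
    using tendsto_unique[OF finite_subsets_at_top_neq_bot tendsto_const] by metis
qed

section \<open>Comparison with an invariant expectation\<close>

context
  fixes \<Phi>
  assumes Phi: "invariant_expectation J \<pi> \<Omega> U \<Phi>"
begin

lemma expectation_in: "X \<in> generated_vN_algebra \<pi> \<Longrightarrow> \<Phi> X \<in> invariant_center J \<pi> U"
  and expectation_id: "\<Phi> id = id"
  and expectation_add: "X \<in> generated_vN_algebra \<pi> \<Longrightarrow> Y \<in> generated_vN_algebra \<pi> \<Longrightarrow>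
    \<Phi> (\<lambda>x. X x + Y x) = (\<lambda>x. \<Phi> X x + \<Phi> Y x)"
  and expectation_scaleC: "X \<in> generated_vN_algebra \<pi> \<Longrightarrow> \<Phi> (\<lambda>x. c *\<^sub>C X x) = (\<lambda>x. c *\<^sub>C \<Phi> X x)"
  and expectation_positive: "X \<in> generated_vN_algebra \<pi> \<Longrightarrow> positive_op X \<Longrightarrow> positive_op (\<Phi> X)"
  and expectation_state: "X \<in> generated_vN_algebra \<pi> \<Longrightarrow> cinner (\<Phi> X \<Omega>) \<Omega> = cinner (X \<Omega>) \<Omega>"
  using Phi id_in_invariant_center
  by (auto simp: invariant_expectation_def conditional_expectation_def)

lemma expectation_module:
  assumes "X \<in> generated_vN_algebra \<pi>" "Z \<in> invariant_center J \<pi> U"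
  shows "\<Phi> (Z \<circ> X) = Z \<circ> \<Phi> X"
proof -
  have "\<Phi> (Z \<circ> X \<circ> id) = Z \<circ> \<Phi> X \<circ> id"
    using Phi assms id_in_invariant_center
    unfolding invariant_expectation_def conditional_expectation_def by blast
  then show ?thesis
    by simp
qed

lemma expectation_rep_add: "\<Phi> (\<pi> (A + B)) x = \<Phi> (\<pi> A) x + \<Phi> (\<pi> B) x"
proof -
  have "\<pi> (A + B) = (\<lambda>x. \<pi> A x + \<pi> B x)"
    by (simp add: fun_eq_iff rep_add)
  then show ?thesis
    using rep_in_generated_vN_algebra by (simp add: expectation_add)
qed

lemma expectation_rep_scaleC: "\<Phi> (\<pi> (c *\<^sub>C A)) x = c *\<^sub>C \<Phi> (\<pi> A) x"
proof -
  have "\<pi> (c *\<^sub>C A) = (\<lambda>x. c *\<^sub>C \<pi> A x)"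
    by (simp add: fun_eq_iff rep_scaleC)
  then show ?thesis
    using rep_in_generated_vN_algebra by (simp add: expectation_scaleC)
qed

text \<open>Adding a large multiple of the identity makes a self-adjoint element positive.\<close>

lemma expectation_symmetric:
  assumes A: "star A = A"
  shows "cinner (\<Phi> (\<pi> A) x) y = cinner x (\<Phi> (\<pi> A) y)"
proof (rule symmetric_if_real_form)
  show "bounded_clinear (\<Phi> (\<pi> A))"
    by (intro invariant_centerD(1) expectation_in rep_in_generated_vN_algebra)
  fix x
  define c where "c = complex_of_real (repnorm A)"
  define B where "B = A + c *\<^sub>C 1"
  have "cinner (\<pi> B z) z \<in> \<real>\<^sub>\<ge>\<^sub>0" for z
  proof -
    have sym: "cinner (\<pi> A u) v = cinner u (\<pi> A v)" for u v
      using rep_star[of A u v] by (simp add: A)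
    have real: "cinner (\<pi> A z) z \<in> \<real>"
      by (rule real_form_if_symmetric[OF sym])
    have "cmod (cinner (\<pi> A z) z) \<le> repnorm A * norm z * norm z"
      by (rule order_trans[OF norm_cinner_le mult_right_mono[OF norm_rep_le]]) simp
    then have "- (repnorm A * (norm z)\<^sup>2) \<le> Re (cinner (\<pi> A z) z)"
      using abs_Re_le_cmod[of "cinner (\<pi> A z) z"] by (simp add: power2_eq_square)
    moreover have "cinner (\<pi> B z) z = cinner (\<pi> A z) z + complex_of_real (repnorm A * (norm z)\<^sup>2)"
      by (simp add: B_def c_def rep_add rep_scaleC rep_one cinner_add_left cinner_scaleC_left
          cinner_self)
    ultimately show ?thesis
      using real
      by (simp add: complex_nonneg_Reals_iff complex_is_Real_iff del: of_real_power of_real_mult)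
  qed
  then have "positive_op (\<pi> B)"
    by (simp add: positive_op_def rep_bounded_clinear)
  then have pos: "cinner (\<Phi> (\<pi> B) x) x \<in> \<real>\<^sub>\<ge>\<^sub>0"
    using expectation_positive[OF rep_in_generated_vN_algebra] by (simp add: positive_op_def)
  have "cinner (\<Phi> (\<pi> B) x) x = cinner (\<Phi> (\<pi> A) x) x + complex_of_real (repnorm A * (norm x)\<^sup>2)"
    by (simp add: B_def c_def expectation_rep_add expectation_rep_scaleC rep_one expectation_id
        cinner_add_left cinner_scaleC_left cinner_self)
  then show "cinner (\<Phi> (\<pi> A) x) x \<in> \<real>"
    using pos
    by (simp add: complex_nonneg_Reals_iff complex_is_Real_iff del: of_real_power of_real_mult)
qed

text \<open>\<open>D = \<Phi> (\<pi> A) - sym_lim A\<close> is a symmetric element of the invariant center, and both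
  expectations are adjoint to the inclusion of that center, so \<open>\<parallel>D \<Omega>\<parallel>\<^sup>2 = \<langle>D D \<Omega>, \<Omega>\<rangle> = 0\<close>.\<close>

lemma expectation_eq_sym_lim_self_adjoint:
  assumes A: "star A = A"
  shows "\<Phi> (\<pi> A) x = sym_lim A x"
proof -
  define D where "D x = \<Phi> (\<pi> A) x - sym_lim A x" for x
  have D: "D \<in> invariant_center J \<pi> U"
    unfolding D_def[abs_def]
    by (intro invariant_center_diff expectation_in rep_in_generated_vN_algebra sym_lim_in_invariant_center)
  have "cinner (D (\<Phi> (\<pi> A) \<Omega>)) \<Omega> = cinner (\<Phi> (D \<circ> \<pi> A) \<Omega>) \<Omega>"
    using expectation_module[OF rep_in_generated_vN_algebra D] by simp
  also have "\<dots> = cinner (D (\<pi> A \<Omega>)) \<Omega>"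
    using expectation_state[OF invariant_centerD(5)[OF D]] by simp
  also have "\<dots> = cinner (D (sym_lim A \<Omega>)) \<Omega>"
    by (rule vector_state_sym_lim[OF D, symmetric])
  finally have "cinner (D (D \<Omega>)) \<Omega> = 0"
    \<comment> \<open>Only the inner \<open>D\<close> is unfolded; linearity of the outer one then
      splits off the two equal terms.\<close>
    by (subst (2) D_def)
      (simp add: bounded_clinearD(4)[OF invariant_centerD(1)[OF D]] cinner_diff_left)
  moreover have "cinner (D u) v = cinner u (D v)" for u v
    by (simp add: D_def cinner_diff_left cinner_diff_right expectation_symmetric[OF A] sym_lim_symmetric[OF A])
  ultimately have "D \<Omega> = 0"
    by (simp add: cinner_self)
  then show ?thesis
    using vanishes_if_vanishes_at_Omega[OF D] by (simp add: D_def)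
qed

text \<open>Both sides are complex linear in \<open>A\<close>, so the self-adjoint case applies to
  the real part \<open>B\<close> and the imaginary part \<open>C\<close> of
  \<open>A\<close>.\<close>

lemma expectation_eq_sym_lim: "\<Phi> (\<pi> A) x = sym_lim A x"
proof -
  define B C where "B = (1 / 2) *\<^sub>C A + (1 / 2) *\<^sub>C star A"
    and "C = (- \<i> / 2) *\<^sub>C A + (\<i> / 2) *\<^sub>C star A"
  have "star B = B" "star C = C"
    by (simp_all add: B_def C_def star_add star_scaleC star_star add.commute)
  moreover have "A = B + \<i> *\<^sub>C C"
  proof -
    have "B + \<i> *\<^sub>C C = ((1 / 2) *\<^sub>C A + (1 / 2) *\<^sub>C A) + ((1 / 2) *\<^sub>C star A + (- 1 / 2) *\<^sub>C star A)"
      by (simp add: B_def C_def scaleC_add_right scaleC_scaleC)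
    also have "\<dots> = A"
      by (simp flip: scaleC_add_left)
        (metis scaleC_of_real of_real_0 of_real_1 scaleR_one scaleR_zero_left add.right_neutral)
    finally show ?thesis
      by simp
  qed
  ultimately show ?thesis
    by (simp add: expectation_rep_add expectation_rep_scaleC sym_lim_add sym_lim_scaleC
        expectation_eq_sym_lim_self_adjoint)
qed

end

end

theorem proposition4p3:
  fixes J :: "'j set"
    and a :: "'j \<Rightarrow> 'a::cstar_algebra"
    and \<alpha> :: "('j \<Rightarrow> 'j) \<Rightarrow> 'a \<Rightarrow> 'a"
    and \<phi> :: "'a \<Rightarrow> complex"
    and \<pi> :: "'a \<Rightarrow> 'h::chilbert_space \<Rightarrow> 'h"
    and \<Omega> :: 'h
    and U :: "('j \<Rightarrow> 'j) \<Rightarrow> 'h \<Rightarrow> 'h"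
    and \<Phi> :: "('h \<Rightarrow> 'h) \<Rightarrow> 'h \<Rightarrow> 'h"
    and A :: 'a
  assumes "infinite J"
    and "car_algebra J a"
    and "car_permutation_action J a \<alpha>"
    and "\<phi> \<in> symmetric_states J \<alpha>"
    and "gns_triple \<phi> \<pi> \<Omega>"
    and "gns_permutation_rep J \<alpha> \<pi> \<Omega> U"
    and "invariant_expectation J \<pi> \<Omega> U \<Phi>"
  shows "wot_tendsto
           (\<lambda>I x. (1 / real (card {g. g permutes I})) *\<^sub>R
              (\<Sum>g | g permutes I. (U g \<circ> \<pi> A \<circ> inv (U g)) x))
           (\<Phi> (\<pi> A))
           (finite_subsets_at_top J)"
proof -
  interpret symmetric_gns \<pi> J a \<alpha> \<Omega> U
    using assms by unfold_locales (auto simp: gns_triple_def)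
  show ?thesis
    unfolding wot_tendsto_def perm_avg_def[symmetric]
  proof (intro allI)
    fix x y
    have "((\<lambda>I. cinner (\<pi> (sym_avg I A) x) y) \<longlongrightarrow> cinner (\<Phi> (\<pi> A) x) y) net"
      unfolding expectation_eq_sym_lim[OF assms(7)]
      by (intro tendsto_cinner sym_lim_tendsto tendsto_const)
    moreover have "\<forall>\<^sub>F I in net. cinner (\<pi> (sym_avg I A) x) y
        = cinner (perm_avg I (\<lambda>g. (U g \<circ> \<pi> A \<circ> inv (U g)) x)) y"
      using eventually_net
    proof eventually_elim
      case (elim I)
      then have I: "finite I" "I \<subseteq> J"
        by auto
      \<comment> \<open>Linearity of \<open>\<pi>\<close> and the unitary implementation of the
        action identify the represented average with the average of operators.\<close>
      have "\<pi> (sym_avg I A) x = perm_avg I (\<lambda>g. (U g \<circ> \<pi> A \<circ> inv (U g)) x)"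
        unfolding rep_sym_avg[OF I]
        by (intro perm_avg_cong) (simp only: rep_alpha[OF finitary[OF I]])
      then show ?case
        by simp
    qed
    ultimately show "((\<lambda>I. cinner (perm_avg I (\<lambda>g. (U g \<circ> \<pi> A \<circ> inv (U g)) x)) y)
        \<longlongrightarrow> cinner (\<Phi> (\<pi> A) x) y) net"
      by (rule Lim_transform_eventually)
  qed
qed

end
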